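(* As $\varepsilon\downarrow0$, $$K_\varepsilon=K_0+O(\varepsilon),\qquad K_\varepsilon^*=K_0^*+O(\varepsilon),$$ where $K_0=\Psi_1\Theta^{-1}+2V^{-1}D$ and $K_0^*=\Psi_1^*\Theta^{-1}-2V^{-1}D$. The matrices $-K_0$ and $K_0^*$ are solutions of the equation $$X^2+2XV^{-1}D+2\Theta^{-1}Q\Theta^{-1}=0,$$ and are irreducible. Furthermore, $K_0$ has $m$ eigenvalues with strictly negative real parts, and it is the unique such solution (that is, the unique matrix $K$ with all eigenvalues of strictly negative real part such that $X=-K$ solves the equation); $K_0^*$ has one eigenvalue equal to zero and $m-1$ eigenvalues with strictly negative real parts, and it is the unique solution of the equation with this property.
   Context: Let $m\ge1$, $\mathcal M=\{1,\dots,m\}$, $Q$ an irreducible generator on $\mathcal M$ with stationary distribution $\boldsymbol\alpha$ (row vector). Let $\mu_i\in\mathbb R$, $\sigma_i>0$ for all $i\in\mathcal M$, $D=\mathrm{diag}(\mu_i)$, $V=\mathrm{diag}(\sigma_i^2)$, $\Theta=\sqrt V=\mathrm{diag}(\sigma_i)$. Assume $\boldsymbol\alpha D\boldsymbol 1<0$ ($\boldsymbol 1$ a column vector of ones). For $\varepsilon>0$ let $T^{++}_\varepsilon=T^{--}_\varepsilon=Q-\varepsilon^{-2}I$, $T^{+-}_\varepsilon=T^{-+}_\varepsilon=\varepsilon^{-2}I$, $C^+_\varepsilon=D+\varepsilon^{-1}\Theta$, $C^-_\varepsilon=D-\varepsilon^{-1}\Theta$; $\varepsilon$ is taken small enough that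 the diagonal of $C_\varepsilon^+$ is positive and that of $C_\varepsilon^-$ is negative, and $|C_\varepsilon^-|=\varepsilon^{-1}\Theta-D$. Let $(\beta_\varepsilon,\varphi_\varepsilon)$ be a Markov chain on $\{1,2\}\times\mathcal M$ (lexicographic order) with generator $\begin{bmatrix} T^{++}_\varepsilon & T^{+-}_\varepsilon \\ T^{-+}_\varepsilon & T^{--}_\varepsilon \end{bmatrix}$, and let the fluid level $L_\varepsilon$ vary linearly at rate $(C_\varepsilon^+)_{ii}$ while the phase is $(1,i)$ and at rate $(C_\varepsilon^-)_{ii}$ while the phase is $(2,i)$. Let $\xi^+_\varepsilon(x)=\inf\{t<\infty:L_\varepsilon(t)>x\}$, $\xi^-_\varepsilon(x)=\inf\{t<\infty:L_\varepsilon(t)<x\}$, and for any level $x$ $(\Psi_\varepsilon)_{ij}=\mathrm P[\xi^-_\varepsilon(x)<\infty,\beta_\varepsilon(\xi^-_\varepsilon(x))=2,\varphi_\varepsilon(\xi^-_\varepsilon(x))=j\mid L_\varepsilon(0)=x,\beta_\varepsilon(0)=1,\varphi_\varepsilon(0)=i]$, $(\Psi^*_\varepsilon)_{ij}=\mathrm P[\xi^+_\varepsilon(x)<\infty,\beta_\varepsilon(\xi^+_\varepsilon(x))=1,\varphi_\varepsilon(\xi^+_\varepsilon(x))=j\mid L_\varepsilon(0)=x,\beta_\varepsilon(0)=2,\varphi_\varepsilon(0)=i]$. $\Psi_1$ and $\Psi_1^*$ are the matrices in the expansions $\Psi_\varepsilon=I+\varepsilon\Psi_1+O(\varepsilon^2)$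 and $\Psi^*_\varepsilon=I+\varepsilon\Psi^*_1+O(\varepsilon^2)$ as $\varepsilon\to0$. Equivalently, $\Theta^{-1}\Psi_1$ is the unique solution of $X^2+2V^{-1}DX+2V^{-1}Q=0$ with one eigenvalue zero and $m-1$ eigenvalues of strictly negative real part, and $-\Theta^{-1}\Psi_1^*$ is the unique solution of the same equation with $m$ eigenvalues of strictly positive real part. Finally, $K_\varepsilon=(C^+_\varepsilon)^{-1}T^{++}_\varepsilon+\Psi_\varepsilon|C^-_\varepsilon|^{-1}T^{-+}_\varepsilon$ and $K^*_\varepsilon=\Psi^*_\varepsilon(C^+_\varepsilon)^{-1}T^{+-}_\varepsilon+|C^-_\varepsilon|^{-1}T^{--}_\varepsilon$. Eigenvalues are counted with multiplicity. *)

theory Defs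
  imports "HOL-Probability.Probability" "HOL-Library.Landau_Symbols"
    "Jordan_Normal_Form.Char_Poly"
begin

text \<open>
  Matrices are those of \<^theory>\<open>Jordan_Normal_Form.Matrix\<close>, indexed from 0: the phase set
  \<open>{1,...,m}\<close> is rendered as \<open>{..<m}\<close>. Vectors of phase parameters are
  functions on \<open>nat\<close>, of which only the values below \<open>m\<close> matter.
\<close>

subsection \<open>Matrices\<close>

text \<open>The inverse of the diagonal matrix \<open>mat_diag m d\<close>, when all \<open>d i\<close> are nonzero.\<close>

definition diag_inv :: "nat \<Rightarrow> (nat \<Rightarrow> real) \<Rightarrow> real mat" where
  "diag_inv m d = mat_diag m (\<lambda>i. inverse (d i))"

text \<open>Complex eigenvalues of a real square matrix, with algebraic multiplicity.\<close>

definition eigs :: "real mat \<Rightarrow> complex multiset" where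
  "eigs A = proots (char_poly (map_mat complex_of_real A))"

text \<open>
  Irreducibility in the sense of the directed graph of nonzero entries being strongly connected;
  in particular every 1-by-1 matrix is irreducible.
\<close>

definition irreducible_mat :: "nat \<Rightarrow> real mat \<Rightarrow> bool" where
  "irreducible_mat m A \<longleftrightarrow>
     (\<forall>i<m. \<forall>j<m. (i, j) \<in> {(k, l). k < m \<and> l < m \<and> A $$ (k, l) \<noteq> 0}\<^sup>*)"

definition generator_mat :: "nat \<Rightarrow> real mat \<Rightarrow> bool" where
  "generator_mat m Q \<longleftrightarrow> Q \<in> carrier_mat m m \<and>
     (\<forall>i<m. \<forall>j<m. i \<noteq> j \<longrightarrow> 0 \<le> Q $$ (i, j)) \<and>
     (\<forall>i<m. (\<Sum>j<m. Q $$ (i, j)) = 0)"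

definition stationary_dist :: "nat \<Rightarrow> real mat \<Rightarrow> (nat \<Rightarrow> real) \<Rightarrow> bool" where
  "stationary_dist m Q \<alpha> \<longleftrightarrow>
     (\<forall>i<m. 0 \<le> \<alpha> i) \<and> (\<Sum>i<m. \<alpha> i) = 1 \<and>
     (\<forall>j<m. (\<Sum>i<m. \<alpha> i * Q $$ (i, j)) = 0)"

text \<open>\<open>F \<epsilon> = G \<epsilon> + O(g \<epsilon>)\<close> as \<open>\<epsilon> \<down> 0\<close>, for \<open>m\<close>-by-\<open>m\<close> matrices (entrywise).\<close>

definition mat_eq_up_to ::
  "nat \<Rightarrow> (real \<Rightarrow> real mat) \<Rightarrow> (real \<Rightarrow> real mat) \<Rightarrow> (real \<Rightarrow> real) \<Rightarrow> bool" where
  "mat_eq_up_to m F G g \<longleftrightarrow>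
     (\<forall>i<m. \<forall>j<m. (\<lambda>\<epsilon>. F \<epsilon> $$ (i, j) - G \<epsilon> $$ (i, j)) \<in> O[at_right 0](g))"


subsection \<open>Continuous-time Markov chains on a finite state space\<close>

text \<open>The entry \<open>(a, b)\<close> of the matrix exponential \<open>exp (t T)\<close>.\<close>

definition transition_prob :: "real mat \<Rightarrow> real \<Rightarrow> nat \<Rightarrow> nat \<Rightarrow> real" where
  "transition_prob T t a b = (\<Sum>k. t ^ k / fact k * (T ^\<^sub>m k) $$ (a, b))"

text \<open>
  Under \<open>M\<close>, the process \<open>J\<close> is a Markov chain on \<open>S\<close> started in \<open>s\<close>, with generator \<open>T\<close> and
  piecewise constant right-continuous paths having finitely many jumps in bounded time.
  The map \<open>ix\<close> gives the row (and column) of \<open>T\<close> belonging to a state.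
\<close>

definition markov_chain ::
  "'w measure \<Rightarrow> 's set \<Rightarrow> ('s \<Rightarrow> nat) \<Rightarrow> real mat \<Rightarrow> 's \<Rightarrow> (real \<Rightarrow> 'w \<Rightarrow> 's) \<Rightarrow> bool" where
  "markov_chain M S ix T s J \<longleftrightarrow>
     prob_space M \<and>
     (\<forall>t\<ge>0. J t \<in> measurable M (count_space S)) \<and>
     (\<forall>\<omega>\<in>space M. \<forall>t\<ge>0. \<forall>\<^sub>F u in at_right t. J u \<omega> = J t \<omega>) \<and>
     (\<forall>\<omega>\<in>space M. \<forall>t>0. \<exists>z. \<forall>\<^sub>F u in at_left t. J u \<omega> = z) \<and>
     (\<forall>(n::nat) (t :: nat \<Rightarrow> real) (z :: nat \<Rightarrow> 's).
        t 0 = 0 \<longrightarrow> (\<forall>k<n. t k \<le> t (Suc k)) \<longrightarrow> (\<forall>k\<le>n. z k \<in> S) \<longrightarrow>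
        measure M {\<omega> \<in> space M. \<forall>k\<le>n. J (t k) \<omega> = z k} =
          (if z 0 = s
           then \<Prod>k<n. transition_prob T (t (Suc k) - t k) (ix (z k)) (ix (z (Suc k)))
           else 0))"


subsection \<open>The fluid queue\<close>

definition Cplus :: "(nat \<Rightarrow> real) \<Rightarrow> (nat \<Rightarrow> real) \<Rightarrow> real \<Rightarrow> nat \<Rightarrow> real" where
  "Cplus \<mu> \<sigma> \<epsilon> i = \<mu> i + inverse \<epsilon> * \<sigma> i"

definition Cminus :: "(nat \<Rightarrow> real) \<Rightarrow> (nat \<Rightarrow> real) \<Rightarrow> real \<Rightarrow> nat \<Rightarrow> real" where
  "Cminus \<mu> \<sigma> \<epsilon> i = \<mu> i - inverse \<epsilon> * \<sigma> i"

definition admissible :: "nat \<Rightarrow> (nat \<Rightarrow> real) \<Rightarrow> (nat \<Rightarrow> real) \<Rightarrow> real \<Rightarrow> bool" where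
  "admissible m \<mu> \<sigma> \<epsilon> \<longleftrightarrow>
     0 < \<epsilon> \<and> (\<forall>i<m. 0 < Cplus \<mu> \<sigma> \<epsilon> i \<and> Cminus \<mu> \<sigma> \<epsilon> i < 0)"

text \<open>\<open>Tdiag\<close> is \<open>T\<^sup>+\<^sup>+ = T\<^sup>-\<^sup>-\<close> and \<open>Toff\<close> is \<open>T\<^sup>+\<^sup>- = T\<^sup>-\<^sup>+\<close>.\<close>

definition Tdiag :: "nat \<Rightarrow> real mat \<Rightarrow> real \<Rightarrow> real mat" where
  "Tdiag m Q \<epsilon> = Q - inverse (\<epsilon>\<^sup>2) \<cdot>\<^sub>m 1\<^sub>m m"

definition Toff :: "nat \<Rightarrow> real \<Rightarrow> real mat" where
  "Toff m \<epsilon> = inverse (\<epsilon>\<^sup>2) \<cdot>\<^sub>m 1\<^sub>m m"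

definition fluid_generator :: "nat \<Rightarrow> real mat \<Rightarrow> real \<Rightarrow> real mat" where
  "fluid_generator m Q \<epsilon> =
     four_block_mat (Tdiag m Q \<epsilon>) (Toff m \<epsilon>) (Toff m \<epsilon>) (Tdiag m Q \<epsilon>)"

text \<open>
  States of the phase process are pairs \<open>(b, i)\<close> with \<open>b \<in> {1, 2}\<close> and \<open>i < m\<close>, in
  lexicographic order. Under \<open>M\<close> the process starts in phase \<open>s\<close> at level \<open>y\<close>; the level grows
  by the integral of the rate of the current phase.
\<close>

definition fluid_queue ::
  "nat \<Rightarrow> (nat \<Rightarrow> real) \<Rightarrow> (nat \<Rightarrow> real) \<Rightarrow> real mat \<Rightarrow> real \<Rightarrow> 'w measure \<Rightarrow> real \<Rightarrow> nat \<times> nat \<Rightarrow>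
   (real \<Rightarrow> 'w \<Rightarrow> nat) \<Rightarrow> (real \<Rightarrow> 'w \<Rightarrow> nat) \<Rightarrow> (real \<Rightarrow> 'w \<Rightarrow> real) \<Rightarrow> bool" where
  "fluid_queue m \<mu> \<sigma> Q \<epsilon> M y s \<beta> \<phi> L \<longleftrightarrow>
     markov_chain M ({1, 2} \<times> {..<m}) (\<lambda>(b, i). (b - 1) * m + i) (fluid_generator m Q \<epsilon>) s
       (\<lambda>t \<omega>. (\<beta> t \<omega>, \<phi> t \<omega>)) \<and>
     (\<forall>\<omega>\<in>space M. \<forall>t\<ge>0.
        ((\<lambda>u. if \<beta> u \<omega> = 1 then Cplus \<mu> \<sigma> \<epsilon> (\<phi> u \<omega>) else Cminus \<mu> \<sigma> \<epsilon> (\<phi> u \<omega>))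
          has_integral (L t \<omega> - L 0 \<omega>)) {0..t}) \<and>
     L 0 \<in> borel_measurable M \<and> (AE \<omega> in M. L 0 \<omega> = y)"

text \<open>First passage times \<open>\<xi>\<^sup>+(x)\<close> and \<open>\<xi>\<^sup>-(x)\<close>; the infimum of the empty set is \<open>\<infinity>\<close>.\<close>

definition passage_above :: "(real \<Rightarrow> 'w \<Rightarrow> real) \<Rightarrow> real \<Rightarrow> 'w \<Rightarrow> ereal" where
  "passage_above L x \<omega> = Inf (ereal ` {t. 0 \<le> t \<and> L t \<omega> > x})"

definition passage_below :: "(real \<Rightarrow> 'w \<Rightarrow> real) \<Rightarrow> real \<Rightarrow> 'w \<Rightarrow> ereal" where
  "passage_below L x \<omega> = Inf (ereal ` {t. 0 \<le> t \<and> L t \<omega> < x})"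

text \<open>
  In the next two definitions \<open>P y s\<close> is the law given that the process starts at level \<open>y\<close> in
  phase \<open>s\<close>.
\<close>

definition Psi ::
  "nat \<Rightarrow> (real \<Rightarrow> nat \<times> nat \<Rightarrow> 'w measure) \<Rightarrow>
   (real \<Rightarrow> 'w \<Rightarrow> nat) \<Rightarrow> (real \<Rightarrow> 'w \<Rightarrow> nat) \<Rightarrow> (real \<Rightarrow> 'w \<Rightarrow> real) \<Rightarrow> real \<Rightarrow> real mat" where
  "Psi m P \<beta> \<phi> L x = Matrix.mat m m (\<lambda>(i, j).
     measure (P x (1, i)) {\<omega> \<in> space (P x (1, i)).
       passage_below L x \<omega> < \<infinity> \<and>
       \<beta> (real_of_ereal (passage_below L x \<omega>)) \<omega> = 2 \<and>
       \<phi> (real_of_ereal (passage_below L x \<omega>)) \<omega> = j})"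

definition Psi_star ::
  "nat \<Rightarrow> (real \<Rightarrow> nat \<times> nat \<Rightarrow> 'w measure) \<Rightarrow>
   (real \<Rightarrow> 'w \<Rightarrow> nat) \<Rightarrow> (real \<Rightarrow> 'w \<Rightarrow> nat) \<Rightarrow> (real \<Rightarrow> 'w \<Rightarrow> real) \<Rightarrow> real \<Rightarrow> real mat" where
  "Psi_star m P \<beta> \<phi> L x = Matrix.mat m m (\<lambda>(i, j).
     measure (P x (2, i)) {\<omega> \<in> space (P x (2, i)).
       passage_above L x \<omega> < \<infinity> \<and>
       \<beta> (real_of_ereal (passage_above L x \<omega>)) \<omega> = 1 \<and>
       \<phi> (real_of_ereal (passage_above L x \<omega>)) \<omega> = j})"

definition K_mat ::
  "nat \<Rightarrow> (nat \<Rightarrow> real) \<Rightarrow> (nat \<Rightarrow> real) \<Rightarrow> real mat \<Rightarrow> real \<Rightarrow> real mat \<Rightarrow> real mat" where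
  "K_mat m \<mu> \<sigma> Q \<epsilon> \<Psi> =
     diag_inv m (Cplus \<mu> \<sigma> \<epsilon>) * Tdiag m Q \<epsilon> +
     \<Psi> * diag_inv m (\<lambda>i. \<bar>Cminus \<mu> \<sigma> \<epsilon> i\<bar>) * Toff m \<epsilon>"

definition K_star_mat ::
  "nat \<Rightarrow> (nat \<Rightarrow> real) \<Rightarrow> (nat \<Rightarrow> real) \<Rightarrow> real mat \<Rightarrow> real \<Rightarrow> real mat \<Rightarrow> real mat" where
  "K_star_mat m \<mu> \<sigma> Q \<epsilon> \<Psi>s =
     \<Psi>s * diag_inv m (Cplus \<mu> \<sigma> \<epsilon>) * Toff m \<epsilon> +
     diag_inv m (\<lambda>i. \<bar>Cminus \<mu> \<sigma> \<epsilon> i\<bar>) * Tdiag m Q \<epsilon>"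


subsection \<open>The limiting matrices\<close>

text \<open>\<open>V\<^sup>-\<^sup>1 D\<close>, with \<open>V = diag (\<sigma>\<^sub>i\<^sup>2)\<close> and \<open>D = diag (\<mu>\<^sub>i)\<close>.\<close>

definition VinvD :: "nat \<Rightarrow> (nat \<Rightarrow> real) \<Rightarrow> (nat \<Rightarrow> real) \<Rightarrow> real mat" where
  "VinvD m \<mu> \<sigma> = diag_inv m (\<lambda>i. (\<sigma> i)\<^sup>2) * mat_diag m \<mu>"

text \<open>\<open>X\<^sup>2 + 2 V\<^sup>-\<^sup>1 D X + 2 V\<^sup>-\<^sup>1 Q = 0\<close>\<close>

definition solves_right ::
  "nat \<Rightarrow> (nat \<Rightarrow> real) \<Rightarrow> (nat \<Rightarrow> real) \<Rightarrow> real mat \<Rightarrow> real mat \<Rightarrow> bool" where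
  "solves_right m \<mu> \<sigma> Q X \<longleftrightarrow> X \<in> carrier_mat m m \<and>
     X * X + 2 \<cdot>\<^sub>m (VinvD m \<mu> \<sigma> * X) + 2 \<cdot>\<^sub>m (diag_inv m (\<lambda>i. (\<sigma> i)\<^sup>2) * Q) = 0\<^sub>m m m"

text \<open>\<open>X\<^sup>2 + 2 X V\<^sup>-\<^sup>1 D + 2 \<Theta>\<^sup>-\<^sup>1 Q \<Theta>\<^sup>-\<^sup>1 = 0\<close>, with \<open>\<Theta> = diag (\<sigma>\<^sub>i)\<close>\<close>

definition solves_left ::
  "nat \<Rightarrow> (nat \<Rightarrow> real) \<Rightarrow> (nat \<Rightarrow> real) \<Rightarrow> real mat \<Rightarrow> real mat \<Rightarrow> bool" where
  "solves_left m \<mu> \<sigma> Q X \<longleftrightarrow> X \<in> carrier_mat m m \<and>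
     X * X + 2 \<cdot>\<^sub>m (X * VinvD m \<mu> \<sigma>) + 2 \<cdot>\<^sub>m (diag_inv m \<sigma> * Q * diag_inv m \<sigma>) = 0\<^sub>m m m"

definition K0_mat ::
  "nat \<Rightarrow> (nat \<Rightarrow> real) \<Rightarrow> (nat \<Rightarrow> real) \<Rightarrow> real mat \<Rightarrow> real mat" where
  "K0_mat m \<mu> \<sigma> \<Psi>1 = \<Psi>1 * diag_inv m \<sigma> + 2 \<cdot>\<^sub>m VinvD m \<mu> \<sigma>"

definition K0_star_mat ::
  "nat \<Rightarrow> (nat \<Rightarrow> real) \<Rightarrow> (nat \<Rightarrow> real) \<Rightarrow> real mat \<Rightarrow> real mat" where
  "K0_star_mat m \<mu> \<sigma> \<Psi>1s = \<Psi>1s * diag_inv m \<sigma> - 2 \<cdot>\<^sub>m VinvD m \<mu> \<sigma>"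

text \<open>
  Spectral patterns of an \<open>m\<close>-by-\<open>m\<close> matrix, which has exactly \<open>m\<close> eigenvalues counted with
  multiplicity.
\<close>

definition all_neg :: "nat \<Rightarrow> real mat \<Rightarrow> bool" where
  "all_neg m A \<longleftrightarrow> size {# z \<in># eigs A. Re z < 0 #} = m"

definition all_pos :: "nat \<Rightarrow> real mat \<Rightarrow> bool" where
  "all_pos m A \<longleftrightarrow> size {# z \<in># eigs A. Re z > 0 #} = m"

definition one_zero_rest_neg :: "nat \<Rightarrow> real mat \<Rightarrow> bool" where
  "one_zero_rest_neg m A \<longleftrightarrow>
     count (eigs A) 0 = 1 \<and> size {# z \<in># eigs A. Re z < 0 #} = m - 1"

end

theory Submission
  imports Defs "Jordan_Normal_Form.Schur_Decomposition"
begin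

text \<open>
  Write \<open>B = 2 V\<^sup>-\<^sup>1 D\<close> and \<open>C = 2 V\<^sup>-\<^sup>1 Q\<close>. A solution \<open>U\<close> of \<open>U\<^sup>2 + B U + C = 0\<close> splits the
  quadratic pencil as \<open>z\<^sup>2 + z B + C = (z - Y) (z - U)\<close> with \<open>Y = - B - U\<close>, and then \<open>Y\<close> solves
  \<open>Y\<^sup>2 + Y B + C = 0\<close>, which is the required equation conjugated by \<open>\<Theta>\<close>. Taking determinants,
  the spectra of \<open>Y\<close> and \<open>U\<close> together do not depend on the splitting. The solutions
  \<open>U = \<Theta>\<^sup>-\<^sup>1 \<Psi>\<^sub>1\<close> and \<open>W = - \<Theta>\<^sup>-\<^sup>1 \<Psi>\<^sub>1\<^sup>*\<close> have spectra on different sides of the imaginary axis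
  (0 counted on the left), so \<open>- B - U\<close> has the spectrum of \<open>W\<close> and \<open>- B - W\<close> that of \<open>U\<close>;
  these are \<open>- K\<^sub>0\<close> and \<open>K\<^sub>0\<^sup>*\<close> up to similarity. Uniqueness holds because the difference \<open>X\<close> of
  two solutions \<open>U\<close>, \<open>U'\<close> satisfies the Sylvester equation \<open>Y X = X U'\<close>, where \<open>Y\<close> and \<open>U'\<close> have
  no common eigenvalue. Irreducibility is inherited from \<open>Q\<close>: the matrices leaving a given
  coordinate subspace invariant form an algebra containing the diagonal matrices.
\<close>

section \<open>Eigenvalue multisets of real matrices\<close>

lemma eigs_eq_mset:
  assumes "char_poly (map_mat complex_of_real A) = (\<Prod>a\<leftarrow>as. [:- a, 1:])"
  shows "eigs A = mset as"
proof -
  have "proots (\<Prod>a\<leftarrow>as. [:- a, 1:]) = mset as" for as :: "complex list"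
  proof (induction as)
    case (Cons a as)
    have "(\<Prod>a\<leftarrow>as. [:- a, 1:]) \<noteq> 0"
      by (auto simp: prod_list_zero_iff)
    then show ?case
      using Cons by (simp add: proots_mult del: mult_pCons_left)
  qed simp
  then show ?thesis
    using assms by (simp add: eigs_def)
qed

text \<open>Over the complex numbers the characteristic polynomial splits, so the list of roots that
  \<open>schur_decomposition\<close> takes as input always exists.\<close>

lemma schur_complex:
  fixes A :: "complex mat"
  assumes A: "A \<in> carrier_mat n n"
  obtains T P P' where "similar_mat_wit A T P P'" "upper_triangular T"
    and "char_poly A = (\<Prod>a\<leftarrow>diag_mat T. [:- a, 1:])"
proof -
  obtain as where as: "char_poly A = (\<Prod>a\<leftarrow>as. [:- a, 1:])"
    using char_poly_factorized[OF A] by blast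
  obtain T P P' where "schur_decomposition A as = (T, P, P')"
    by (cases "schur_decomposition A as")
  with schur_decomposition[OF A as this] show ?thesis
    using that as by metis
qed

lemma size_eigs:
  assumes "A \<in> carrier_mat n n"
  shows "size (eigs A) = n"
proof -
  have c: "map_mat complex_of_real A \<in> carrier_mat n n" using assms by simp
  show ?thesis
    using degree_monic_char_poly[OF c] by (simp add: eigs_def size_proots_complex)
qed

lemma in_eigs_iff:
  assumes "A \<in> carrier_mat n n"
  shows "z \<in># eigs A \<longleftrightarrow> eigenvalue (map_mat complex_of_real A) z"
proof -
  have c: "map_mat complex_of_real A \<in> carrier_mat n n" using assms by simp
  have "char_poly (map_mat complex_of_real A) \<noteq> 0"
    using degree_monic_char_poly[OF c] by auto
  then show ?thesis
    unfolding eigenvalue_root_char_poly[OF c] eigs_def by simp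
qed

lemma eigs_similar:
  assumes "similar_mat A A'"
  shows "eigs A = eigs A'"
proof -
  obtain n where "A \<in> carrier_mat n n" "A' \<in> carrier_mat n n"
    using similar_matD[OF assms] by auto
  then show ?thesis
    using char_poly_similar[OF assms] by (simp add: eigs_def of_real_hom.char_poly_hom[of _ n])
qed

text \<open>A Schur form \<open>T\<close> of the complexified matrix turns into a triangular form
  \<open>- T\<close> of its negative, and the diagonals list the eigenvalues with algebraic
  multiplicity.\<close>

lemma eigs_uminus:
  assumes A: "A \<in> carrier_mat n n"
  shows "eigs (- A) = image_mset uminus (eigs A)"
proof -
  let ?A = "map_mat complex_of_real A"
  have c: "?A \<in> carrier_mat n n" using A by simp
  obtain T P P' where T: "similar_mat_wit ?A T P P'" "upper_triangular T"
    and cp: "char_poly ?A = (\<Prod>a\<leftarrow>diag_mat T. [:- a, 1:])"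
    using schur_complex[OF c] .
  note w = similar_mat_witD2[OF c T(1)]
  have neg: "map_mat complex_of_real (- A) = - ?A"
    using A by auto
  have "similar_mat (- ?A) (- T)"
    using w by (intro similar_matI[of _ _ P P' n]) auto
  then have "char_poly (- ?A) = char_poly (- T)"
    by (rule char_poly_similar)
  also have "\<dots> = (\<Prod>a\<leftarrow>diag_mat (- T). [:- a, 1:])"
    using T(2) w by (intro char_poly_upper_triangular[of _ n]) (auto simp: upper_triangular_def)
  also have "diag_mat (- T) = map uminus (diag_mat T)"
    using w by (auto simp: diag_mat_def)
  finally show ?thesis
    using eigs_eq_mset[OF cp] eigs_eq_mset[of "- A" "map uminus (diag_mat T)"] A
    by (simp add: neg)
qed

lemma all_pos_iff:
  assumes "A \<in> carrier_mat n n"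
  shows "all_pos n A \<longleftrightarrow> (\<forall>z\<in>#eigs A. Re z > 0)"
proof
  assume "all_pos n A"
  then have "filter_mset (\<lambda>z. Re z > 0) (eigs A) = eigs A"
    using size_eigs[OF assms] unfolding all_pos_def
    by (metis multiset_filter_subset mset_subset_size nat_less_le subset_mset.le_neq_trans)
  then show "\<forall>z\<in>#eigs A. Re z > 0"
    by (simp add: filter_mset_eq_conv)
next
  assume "\<forall>z\<in>#eigs A. Re z > 0"
  then have "filter_mset (\<lambda>z. Re z > 0) (eigs A) = eigs A"
    by (simp add: filter_mset_eq_conv)
  then show "all_pos n A"
    using size_eigs[OF assms] by (simp add: all_pos_def)
qed

lemma all_neg_iff:
  assumes "A \<in> carrier_mat n n"
  shows "all_neg n A \<longleftrightarrow> all_pos n (- A)"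
proof -
  have "filter_mset (\<lambda>z. Re z > 0) (eigs (- A)) = image_mset uminus (filter_mset (\<lambda>z. Re z < 0) (eigs A))"
    by (simp add: eigs_uminus[OF assms] filter_mset_image_mset)
  then show ?thesis
    by (simp add: all_neg_def all_pos_def)
qed

text \<open>The pattern already accounts for 1 + (n - 1) = n eigenvalues, so by
  \<open>size_eigs\<close> none is left for the open right half-plane.\<close>

lemma one_zero_rest_neg_nonpos:
  assumes A: "A \<in> carrier_mat n n" and n: "n \<ge> 1" and "one_zero_rest_neg n A" and z: "z \<in># eigs A"
  shows "\<not> Re z > 0"
proof
  assume pos: "Re z > 0"
  have "filter_mset (\<lambda>z. Re z < 0) (eigs A) + filter_mset (\<lambda>z. z = 0) (eigs A) + filter_mset (\<lambda>z. Re z > 0) (eigs A)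
      \<subseteq># eigs A"
    by (auto simp: subseteq_mset_def)
  note size_mset_mono[OF this]
  moreover have "size (filter_mset (\<lambda>z. z = 0) (eigs A)) = count (eigs A) 0"
    by (simp add: filter_eq_replicate_mset)
  ultimately have "size (filter_mset (\<lambda>z. Re z < 0) (eigs A)) + count (eigs A) 0 +
      size (filter_mset (\<lambda>z. Re z > 0) (eigs A)) \<le> n"
    using size_eigs[OF A] by simp
  then have "filter_mset (\<lambda>z. Re z > 0) (eigs A) = {#}"
    using assms by (simp add: one_zero_rest_neg_def)
  then show False
    using pos z by (metis empty_not_add_mset filter_mset_add_mset multi_member_split)
qed

section \<open>Spectra of two factors of a monic quadratic matrix polynomial\<close>

text \<open>The indeterminate is a scalar and commutes with all matrices, so (z - Y) (z - U) expands
  to z^2 - z (Y + U) + Y U even if \<open>Y\<close> and \<open>U\<close> do not commute. What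
  matters is that only the sum and the ordered product of the factors occur on the right.\<close>

lemma char_poly_matrix_mult:
  fixes Y U :: "'a::comm_ring_1 mat"
  assumes Y: "Y \<in> carrier_mat n n" and U: "U \<in> carrier_mat n n"
  shows "char_poly_matrix Y * char_poly_matrix U =
    [:0, 1:] \<cdot>\<^sub>m ([:0, 1:] \<cdot>\<^sub>m 1\<^sub>m n) - [:0, 1:] \<cdot>\<^sub>m map_mat (\<lambda>a. [:a:]) (Y + U) +
    map_mat (\<lambda>a. [:a:]) (Y * U)"
proof -
  let ?z = "[:0, 1:] :: 'a poly" and ?c = "map_mat (\<lambda>a::'a. [:a:])"
  let ?Z = "?z \<cdot>\<^sub>m 1\<^sub>m n"
  have cpm: "char_poly_matrix A = ?Z - ?c A" if "A \<in> carrier_mat n n" for A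
    using that by (auto simp: char_poly_matrix_def)
  have "(?Z - ?c Y) * (?Z - ?c U) = ?Z * (?Z - ?c U) - ?c Y * (?Z - ?c U)"
    using Y U by (intro minus_mult_distrib_mat) auto
  also have "?Z * (?Z - ?c U) = ?z \<cdot>\<^sub>m (?Z - ?c U)"
    using U by (subst mult_smult_assoc_mat[of _ n n _ n]) auto
  also have "?c Y * (?Z - ?c U) = ?c Y * ?Z - ?c Y * ?c U"
    using Y U by (intro mult_minus_distrib_mat) auto
  also have "?c Y * ?Z = ?z \<cdot>\<^sub>m ?c Y"
    using Y by (subst mult_smult_distrib[of _ n n _ n]) auto
  also have "?c Y * ?c U = ?c (Y * U)"
    using Y U by (simp add: map_poly_mult(1)[of _ n n _ n])
  also have "?z \<cdot>\<^sub>m (?Z - ?c U) - (?z \<cdot>\<^sub>m ?c Y - ?c (Y * U)) =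
      ?z \<cdot>\<^sub>m ?Z - ?z \<cdot>\<^sub>m ?c (Y + U) + ?c (Y * U)"
    using Y U by (intro eq_matI) auto
  finally show ?thesis
    using Y U by (simp add: cpm)
qed

lemma char_poly_mult_cong:
  fixes Y U Y' U' :: "'a::comm_ring_1 mat"
  assumes carr: "Y \<in> carrier_mat n n" "U \<in> carrier_mat n n" "Y' \<in> carrier_mat n n" "U' \<in> carrier_mat n n"
    and "Y + U = Y' + U'" "Y * U = Y' * U'"
  shows "char_poly Y * char_poly U = char_poly Y' * char_poly U'"
proof -
  have "char_poly_matrix Y * char_poly_matrix U = char_poly_matrix Y' * char_poly_matrix U'"
    using assms by (simp add: char_poly_matrix_mult)
  then show ?thesis
    unfolding char_poly_def using carr
    by (metis char_poly_matrix_closed det_mult)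
qed

lemma map_mat_of_real_add:
  assumes "A \<in> carrier_mat n n" "A' \<in> carrier_mat n n"
  shows "map_mat complex_of_real A + map_mat complex_of_real A' = map_mat complex_of_real (A + A')"
  using assms by (intro eq_matI) auto

lemma eigs_add_cong:
  assumes carr: "Y \<in> carrier_mat n n" "U \<in> carrier_mat n n" "Y' \<in> carrier_mat n n" "U' \<in> carrier_mat n n"
    and "Y + U = Y' + U'" "Y * U = Y' * U'"
  shows "eigs Y + eigs U = eigs Y' + eigs U'"
proof -
  let ?c = "map_mat complex_of_real"
  have nz: "char_poly (?c A) \<noteq> 0" if "A \<in> carrier_mat n n" for A
    using degree_monic_char_poly[of "?c A" n] that by auto
  have "?c Y + ?c U = ?c Y' + ?c U'" "?c Y * ?c U = ?c Y' * ?c U'"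
    using assms by (simp_all add: map_mat_of_real_add[of _ n] flip: of_real_hom.mat_hom_mult[of _ n n _ n])
  then have "char_poly (?c Y) * char_poly (?c U) = char_poly (?c Y') * char_poly (?c U')"
    using carr by (intro char_poly_mult_cong[of _ n]) auto
  then show ?thesis
    using nz carr by (simp add: eigs_def flip: proots_mult)
qed

section \<open>Separation of spectra and uniqueness of solvents\<close>

text \<open>All elements of \<open>A'\<close> satisfy \<open>R\<close> and none of \<open>B\<close>
  does, so \<open>A'\<close> must be contained in \<open>A\<close>; equal sizes then force equality.
  This is how the spectra of single factors are recovered from the sum of the spectra of
  both.\<close>

lemma mset_split_by:
  assumes eq: "A + B = A' + B'" and sz: "size A = size A'"
    and A': "\<forall>z\<in>#A'. R z" and B: "\<forall>z\<in>#B. \<not> R z"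
  shows "A = A' \<and> B = B'"
proof -
  have "filter_mset R A + filter_mset R B = filter_mset R A' + filter_mset R B'"
    using eq by (metis filter_union_mset)
  moreover have "filter_mset R A' = A'" "filter_mset R B = {#}"
    using A' B by (auto simp: filter_mset_eq_conv)
  ultimately have "filter_mset R A = A' + filter_mset R B'" by simp
  then have "A' \<subseteq># A"
    by (metis mset_subset_eq_add_left multiset_filter_subset subset_mset.order_trans)
  then show ?thesis
    using eq sz by (metis add_left_cancel mset_subset_size nat_less_le subset_mset.le_neq_trans)
qed

text \<open>After triangularising \<open>A\<close>, each row of \<open>X\<close> below which all rows vanish is a left eigenvector of \<open>B\<close>.\<close>

lemma sylvester_zero:
  fixes A B X :: "complex mat"
  assumes A: "A \<in> carrier_mat n n" and B: "B \<in> carrier_mat n n" and X: "X \<in> carrier_mat n n"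
    and eq: "A * X = X * B" and disj: "\<And>z. eigenvalue A z \<Longrightarrow> \<not> eigenvalue B z"
  shows "X = 0\<^sub>m n n"
proof -
  obtain T P P' where T: "similar_mat_wit A T P P'" "upper_triangular T"
    and cp: "char_poly A = (\<Prod>a\<leftarrow>diag_mat T. [:- a, 1:])"
    using schur_complex[OF A] .
  note w = similar_mat_witD2[OF A T(1)]
  \<comment> \<open>A change of basis on the left only: the equation becomes
    \<open>T * Z = Z * B\<close> with \<open>T\<close> triangular and \<open>B\<close>
    untouched.\<close>
  define Z where "Z = P' * X"
  have Z: "Z \<in> carrier_mat n n" using w X by (simp add: Z_def)
  have "T * Z = P' * (A * X)"
  proof -
    have "P' * (A * X) = P' * A * X"
      using w(4-) X by (simp add: assoc_mult_mat[of _ n n _ n _ n])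
    also have "P' * A = P' * P * (T * P')"
      using w(4-) by (subst w(3)) (simp add: assoc_mult_mat[of _ n n _ n _ n])
    also have "\<dots> = T * P'" using w by simp
    also have "T * P' * X = T * Z"
      using w(4-) X by (simp add: Z_def assoc_mult_mat[of _ n n _ n _ n])
    finally show ?thesis ..
  qed
  also have "\<dots> = Z * B"
    using w(4-) X B by (simp add: Z_def eq assoc_mult_mat[of _ n n _ n _ n])
  finally have TZ: "T * Z = Z * B" .
  have "row Z i = 0\<^sub>v n" if "i < n" for i
    using that
  proof (induction "n - i" arbitrary: i rule: less_induct)
    case less
    have up: "row Z k = 0\<^sub>v n" if "i < k" "k < n" for k
      using less.hyps[of k] that by simp
    have ev: "eigenvalue A (T $$ (i, i))"
      unfolding eigenvalue_root_char_poly[OF A] cp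
      using less.prems w by (auto simp: poly_prod_list prod_list_zero_iff diag_mat_def)
    have BZ: "transpose_mat B *\<^sub>v row Z i = T $$ (i, i) \<cdot>\<^sub>v row Z i"
    proof (rule eq_vecI)
      fix j assume "j < dim_vec (T $$ (i, i) \<cdot>\<^sub>v row Z i)"
      then have j: "j < n" using Z by simp
      have "(transpose_mat B *\<^sub>v row Z i) $ j = (Z * B) $$ (i, j)"
        using j less.prems Z B by (auto simp: comm_scalar_prod[of _ n])
      also have "\<dots> = (\<Sum>k<n. T $$ (i, k) * Z $$ (k, j))"
        using j less.prems Z w by (simp flip: TZ add: scalar_prod_def lessThan_atLeast0)
      \<comment> \<open>Terms with \<open>k < i\<close> vanish because \<open>T\<close> is upper
        triangular, terms with \<open>k > i\<close> because those rows of \<open>Z\<close> are zero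
        by induction.\<close>
      also have "\<dots> = (\<Sum>k<n. if k = i then T $$ (i, i) * Z $$ (i, j) else 0)"
      proof (rule sum.cong)
        fix k assume k: "k \<in> {..<n}"
        have "Z $$ (k, j) = 0" if "i < k"
          using up[of k] k j Z that by (metis carrier_matD index_row(1) index_zero_vec(1) lessThan_iff)
        then show "T $$ (i, k) * Z $$ (k, j) = (if k = i then T $$ (i, i) * Z $$ (i, j) else 0)"
          using T(2) less.prems w by (cases k i rule: linorder_cases) (auto simp: upper_triangular_def)
      qed simp
      also have "\<dots> = T $$ (i, i) * Z $$ (i, j)"
        using less.prems by simp
      finally show "(transpose_mat B *\<^sub>v row Z i) $ j = (T $$ (i, i) \<cdot>\<^sub>v row Z i) $ j"
        using j less.prems Z by simp
    qed (use Z B in auto)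
    show ?case
    proof (rule ccontr)
      assume "row Z i \<noteq> 0\<^sub>v n"
      then have "eigenvalue (transpose_mat B) (T $$ (i, i))"
        unfolding eigenvalue_def eigenvector_def
        using BZ Z B by (intro exI[of _ "row Z i"]) auto
      \<comment> \<open>A matrix and its transpose have the same characteristic polynomial.\<close>
      then have "eigenvalue B (T $$ (i, i))"
        using B by (simp add: eigenvalue_root_char_poly[of _ n])
      then show False using disj ev by blast
    qed
  qed
  then have "Z = 0\<^sub>m n n"
    using Z by (intro eq_rowI) auto
  then have "P * Z = 0\<^sub>m n n" using w by simp
  moreover have "P * Z = X"
    unfolding Z_def using w(1,6,7) X by (subst assoc_mult_mat[of _ n n _ n _ n, symmetric]) auto
  ultimately show ?thesis by simp
qed

text \<open>The common product cancels in (- B - U) (U - U'), leaving (U - U') U', so the difference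
  satisfies a homogeneous Sylvester equation. Its coefficients are the left factor belonging to
  \<open>U\<close> and the right factor \<open>U'\<close>, which is why \<open>disj\<close> compares
  exactly these two spectra.\<close>

lemma solvent_unique:
  fixes B U U' :: "real mat"
  assumes carr: "B \<in> carrier_mat n n" "U \<in> carrier_mat n n" "U' \<in> carrier_mat n n"
    and eq: "(- B - U) * U = (- B - U') * U'"
    and disj: "\<And>z. z \<in># eigs (- B - U) \<Longrightarrow> z \<notin># eigs U'"
  shows "U = U'"
proof -
  let ?c = "map_mat complex_of_real"
  have "(- B - U) * (U - U') = (U - U') * U'"
  proof -
    have "(- B - U) * (U - U') = (- B - U) * U - (- B - U) * U'"
      using carr by (intro mult_minus_distrib_mat) auto
    also have "\<dots> = (- B - U') * U' - (- B - U) * U'" by (simp add: eq)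
    also have "\<dots> = ((- B - U') - (- B - U)) * U'"
      using carr by (intro minus_mult_distrib_mat[symmetric]) auto
    also have "(- B - U') - (- B - U) = U - U'"
      using carr by (intro eq_matI) auto
    finally show ?thesis .
  qed
  then have "?c ((- B - U) * (U - U')) = ?c ((U - U') * U')" by simp
  then have "?c (- B - U) * ?c (U - U') = ?c (U - U') * ?c U'"
    using carr
    by (subst (asm) (1 2) of_real_hom.mat_hom_mult[of _ n n _ n]) auto
  then have "?c (U - U') = 0\<^sub>m n n"
    using carr disj in_eigs_iff[of "- B - U" n] in_eigs_iff[of U' n]
    by (intro sylvester_zero[of "?c (- B - U)" n "?c U'"]) (auto simp: minus_carrier_mat)
  then have "(U - U') $$ (i, j) = 0" if "i < n" "j < n" for i j
    using that carr by (metis carrier_matD index_map_mat(1) index_minus_mat(2,3) index_zero_mat(1) of_real_eq_0_iff)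
  then show ?thesis
    using carr by (intro eq_matI) auto
qed

section \<open>Irreducibility through invariant sets of indices\<close>

text \<open>The set of indices reachable from \<open>i\<close> in the graph of \<open>X\<close> has
  no outgoing \<open>X\<close>-edge, hence by \<open>closed\<close> no outgoing
  \<open>Q\<close>-edge. Since \<open>Q\<close> is irreducible, this set contains every
  index.\<close>

lemma irreducible_mat_transfer:
  assumes irr: "irreducible_mat m Q"
    and closed: "\<And>A. A \<subseteq> {..<m} \<Longrightarrow> (\<forall>i\<in>A. \<forall>j\<in>{..<m} - A. X $$ (i, j) = 0) \<Longrightarrow>
      (\<forall>i\<in>A. \<forall>j\<in>{..<m} - A. Q $$ (i, j) = 0)"
  shows "irreducible_mat m X"
  unfolding irreducible_mat_def
proof (intro allI impI)
  fix i j assume i: "i < m" and j: "j < m"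
  let ?E = "\<lambda>M :: real mat. {(k, l). k < m \<and> l < m \<and> M $$ (k, l) \<noteq> 0}"
  define A where "A = {k \<in> {..<m}. (i, k) \<in> (?E X)\<^sup>*}"
  have "X $$ (k, l) = 0" if "k \<in> A" "l \<in> {..<m} - A" for k l
  proof (rule ccontr)
    assume "X $$ (k, l) \<noteq> 0"
    then have "(k, l) \<in> ?E X" using that by (auto simp: A_def)
    with that show False by (auto simp: A_def intro: rtrancl_into_rtrancl)
  qed
  then have Q: "\<forall>k\<in>A. \<forall>l\<in>{..<m} - A. Q $$ (k, l) = 0"
    by (intro closed) (auto simp: A_def)
  have "(i, j) \<in> (?E Q)\<^sup>*" using irr i j by (auto simp: irreducible_mat_def)
  then have "j \<in> A"
  proof induction
    case base
    show ?case using i by (simp add: A_def)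
  next
    case (step k l)
    then show ?case using Q by auto
  qed
  then show "(i, j) \<in> (?E X)\<^sup>*" by (simp add: A_def)
qed

section \<open>Diagonal scalings and the factored form of the two quadratic equations\<close>

lemma mat_sum_eq_zero_iff:
  fixes A :: "real mat"
  assumes "A \<in> carrier_mat nr nc" "A' \<in> carrier_mat nr nc" "A'' \<in> carrier_mat nr nc"
  shows "A + A' + A'' = 0\<^sub>m nr nc \<longleftrightarrow> - A' - A = A''"
proof -
  have "x + (y + z) = 0 \<longleftrightarrow> - y - x = z" for x y z :: real
    by linarith
  then show ?thesis
    using assms by (simp add: mat_eq_iff)
qed

lemma VinvD_carrier [simp]: "VinvD m \<mu> \<sigma> \<in> carrier_mat m m"
  by (simp add: VinvD_def diag_inv_def mult_carrier_mat[of _ m m])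

lemma diag_inv_carrier [simp]: "diag_inv m d \<in> carrier_mat m m"
  by (simp add: diag_inv_def)

lemma VinvD_dim [simp]: "dim_row (VinvD m \<mu> \<sigma>) = m" "dim_col (VinvD m \<mu> \<sigma>) = m"
  using VinvD_carrier by blast+

lemma diag_inv_dim [simp]: "dim_row (diag_inv m d) = m" "dim_col (diag_inv m d) = m"
  using diag_inv_carrier by blast+

lemma index_mat_diag: "i < m \<Longrightarrow> j < m \<Longrightarrow> mat_diag m d $$ (i, j) = (if i = j then d j else 0)"
  by (simp add: mat_diag_def)

lemma index_VinvD:
  "i < m \<Longrightarrow> j < m \<Longrightarrow> VinvD m \<mu> \<sigma> $$ (i, j) = (if i = j then \<mu> j / (\<sigma> j)\<^sup>2 else 0)"
  by (simp add: VinvD_def diag_inv_def index_mat_diag divide_inverse)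

lemma index_diag_inv_mult:
  "A \<in> carrier_mat m n \<Longrightarrow> i < m \<Longrightarrow> j < n \<Longrightarrow> (diag_inv m d * A) $$ (i, j) = A $$ (i, j) / d i"
  by (simp add: diag_inv_def mat_diag_mult_left[of _ m n] divide_inverse)

lemma index_mult_diag_inv:
  "A \<in> carrier_mat n m \<Longrightarrow> i < n \<Longrightarrow> j < m \<Longrightarrow> (A * diag_inv m d) $$ (i, j) = A $$ (i, j) / d j"
  by (simp add: diag_inv_def mat_diag_mult_right[of _ n m] divide_inverse)

lemma index_mult_VinvD:
  assumes "A \<in> carrier_mat n m" "i < n" "j < m"
  shows "(A * VinvD m \<mu> \<sigma>) $$ (i, j) = A $$ (i, j) * \<mu> j / (\<sigma> j)\<^sup>2"
  using assms
  by (simp add: VinvD_def diag_inv_def mat_diag_mult_right[of _ n m] divide_inverse)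

text \<open>If no entry of \<open>X\<close> leads out of a set of indices, the same holds for
  \<open>X * X\<close> and for every diagonal multiple of \<open>X\<close>. The equation then passes
  the zeros on to \<open>Q\<close>.\<close>

lemma solves_right_irreducible:
  assumes Q: "Q \<in> carrier_mat m m" "irreducible_mat m Q"
    and \<sigma>: "\<And>i. i < m \<Longrightarrow> 0 < \<sigma> i"
    and X: "solves_right m \<mu> \<sigma> Q X"
  shows "irreducible_mat m X"
proof (rule irreducible_mat_transfer[OF Q(2)], intro ballI)
  have Xc: "X \<in> carrier_mat m m" using X by (simp add: solves_right_def)
  fix A i j
  assume A: "A \<subseteq> {..<m}" and closed: "\<forall>i\<in>A. \<forall>j\<in>{..<m} - A. X $$ (i, j) = 0"
    and i: "i \<in> A" and j: "j \<in> {..<m} - A"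
  have ij: "i < m" "j < m" using A i j by auto
  have "(X * X) $$ (i, j) = (\<Sum>k<m. X $$ (i, k) * X $$ (k, j))"
    using Xc ij by (simp add: scalar_prod_def lessThan_atLeast0)
  also have "\<dots> = 0"
  proof (rule sum.neutral, rule ballI)
    \<comment> \<open>The second factor vanishes for \<open>k\<close> inside \<open>A\<close>, the
      first one for \<open>k\<close> outside.\<close>
    fix k assume "k \<in> {..<m}"
    then show "X $$ (i, k) * X $$ (k, j) = 0"
      using closed i j by (cases "k \<in> A") auto
  qed
  finally have XX: "(X * X) $$ (i, j) = 0" .
  have VX: "(VinvD m \<mu> \<sigma> * X) $$ (i, j) = 0"
    using closed i j ij Xc
    by (simp add: VinvD_def diag_inv_def mat_diag_mult_left[of _ m m])
  have "(X * X + 2 \<cdot>\<^sub>m (VinvD m \<mu> \<sigma> * X) + 2 \<cdot>\<^sub>m (diag_inv m (\<lambda>i. (\<sigma> i)\<^sup>2) * Q)) $$ (i, j) = 0"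
    using X ij by (simp add: solves_right_def)
  then have "2 * (Q $$ (i, j) / (\<sigma> i)\<^sup>2) = 0"
    using XX VX ij Xc Q index_diag_inv_mult[OF Q(1) ij, of "\<lambda>i. (\<sigma> i)\<^sup>2"] 
    by (simp add: del: index_mult_mat(1))
  then show "Q $$ (i, j) = 0"
    using \<sigma>[OF ij(1)] by simp
qed

text \<open>With B = 2 V^-1 D and C = 2 V^-1 Q the equation says that the factors - B - U and U,
  whose sum is - B, have product C. Here the unknown is the right factor; in
  \<open>solves_left_iff\<close> it is the left one.\<close>

lemma solves_right_iff:
  assumes Q: "Q \<in> carrier_mat m m"
  shows "solves_right m \<mu> \<sigma> Q U \<longleftrightarrow> U \<in> carrier_mat m m \<and>
    (- (2 \<cdot>\<^sub>m VinvD m \<mu> \<sigma>) - U) * U = 2 \<cdot>\<^sub>m (diag_inv m (\<lambda>i. (\<sigma> i)\<^sup>2) * Q)"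
proof (cases "U \<in> carrier_mat m m")
  case True
  let ?B = "2 \<cdot>\<^sub>m VinvD m \<mu> \<sigma>"
  have "(- ?B - U) * U = - ?B * U - U * U"
    using True by (intro minus_mult_distrib_mat) auto
  also have "- ?B * U = - (?B * U)"
    using True by (intro uminus_mult_left_mat) auto
  also have "?B * U = 2 \<cdot>\<^sub>m (VinvD m \<mu> \<sigma> * U)"
    using True by (intro mult_smult_assoc_mat) auto
  finally have "(- ?B - U) * U = - (2 \<cdot>\<^sub>m (VinvD m \<mu> \<sigma> * U)) - U * U" .
  then show ?thesis
    using True Q unfolding solves_right_def
    by (subst mat_sum_eq_zero_iff) (auto intro!: mult_carrier_mat[of _ m m])
qed (simp add: solves_right_def)

text \<open>Conjugation by \<open>\<Theta>\<close> turns the left equation into the same factorisation as the right one.\<close>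

definition conj_diag :: "nat \<Rightarrow> (nat \<Rightarrow> real) \<Rightarrow> real mat \<Rightarrow> real mat" where
  "conj_diag m \<sigma> X = diag_inv m \<sigma> * X * mat_diag m \<sigma>"

lemma conj_diag_carrier [simp]: "X \<in> carrier_mat m m \<Longrightarrow> conj_diag m \<sigma> X \<in> carrier_mat m m"
  by (auto simp: conj_diag_def intro!: mult_carrier_mat[of _ m m])

lemma index_conj_diag:
  assumes "X \<in> carrier_mat m m" "i < m" "j < m"
  shows "conj_diag m \<sigma> X $$ (i, j) = X $$ (i, j) * \<sigma> j / \<sigma> i"
  using assms
  by (simp add: conj_diag_def diag_inv_def mat_diag_mult_left[of _ m m] mat_diag_mult_right[of _ m m] divide_inverse)

lemma conj_diag_inject:
  assumes \<sigma>: "\<And>i. i < m \<Longrightarrow> 0 < \<sigma> i" and X: "X \<in> carrier_mat m m" "X' \<in> carrier_mat m m"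
    and eq: "conj_diag m \<sigma> X = conj_diag m \<sigma> X'"
  shows "X = X'"
proof (rule eq_matI)
  fix i j assume "i < dim_row X'" "j < dim_col X'"
  then have ij: "i < m" "j < m" using X by auto
  have "X $$ (i, j) * \<sigma> j / \<sigma> i = X' $$ (i, j) * \<sigma> j / \<sigma> i"
    using arg_cong[OF eq, of "\<lambda>A. A $$ (i, j)"] by (simp add: index_conj_diag X ij)
  then show "X $$ (i, j) = X' $$ (i, j)"
    using \<sigma>[OF ij(1)] \<sigma>[OF ij(2)] by simp
qed (use X in auto)

lemma diag_inv_mult_mat_diag:
  assumes "\<And>i. i < m \<Longrightarrow> 0 < \<sigma> i"
  shows "diag_inv m \<sigma> * mat_diag m \<sigma> = 1\<^sub>m m" "mat_diag m \<sigma> * diag_inv m \<sigma> = 1\<^sub>m m"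
proof -
  have "mat_diag m (\<lambda>i. inverse (\<sigma> i) * \<sigma> i) = 1\<^sub>m m" "mat_diag m (\<lambda>i. \<sigma> i * inverse (\<sigma> i)) = 1\<^sub>m m"
    using assms by (auto simp: mat_eq_iff index_mat_diag carrier_matD[OF mat_diag_dim] less_imp_neq[symmetric])
  then show "diag_inv m \<sigma> * mat_diag m \<sigma> = 1\<^sub>m m" "mat_diag m \<sigma> * diag_inv m \<sigma> = 1\<^sub>m m"
    by (simp_all add: diag_inv_def)
qed

lemma conj_diag_similar:
  assumes "\<And>i. i < m \<Longrightarrow> 0 < \<sigma> i" "X \<in> carrier_mat m m"
  shows "similar_mat (conj_diag m \<sigma> X) X"
  using assms diag_inv_mult_mat_diag[of m \<sigma>]
  by (intro similar_matI[of _ _ "diag_inv m \<sigma>" "mat_diag m \<sigma>" m]) (auto simp: conj_diag_def intro!: mult_carrier_mat[of _ m m])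

lemma conj_diag_mult:
  assumes \<sigma>: "\<And>i. i < m \<Longrightarrow> 0 < \<sigma> i" and X: "X \<in> carrier_mat m m" "X' \<in> carrier_mat m m"
  shows "conj_diag m \<sigma> X * conj_diag m \<sigma> X' = conj_diag m \<sigma> (X * X')"
proof -
  have "conj_diag m \<sigma> X * conj_diag m \<sigma> X' =
      diag_inv m \<sigma> * X * (mat_diag m \<sigma> * diag_inv m \<sigma>) * (X' * mat_diag m \<sigma>)"
    using X by (simp add: conj_diag_def assoc_mult_mat[of _ m m _ m _ m] mult_carrier_mat[of _ m m])
  also have "\<dots> = conj_diag m \<sigma> (X * X')"
    using X diag_inv_mult_mat_diag[OF \<sigma>]
    by (simp add: conj_diag_def assoc_mult_mat[of _ m m _ m _ m] mult_carrier_mat[of _ m m])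
  finally show ?thesis .
qed

text \<open>Conjugation turns the constant term \<Theta>^-1 Q \<Theta>^-1 into V^-1 Q and fixes the
  diagonal matrix V^-1 D. It is injective, so nothing is lost by conjugating the equation.\<close>

lemma solves_left_iff:
  assumes Q: "Q \<in> carrier_mat m m" and \<sigma>: "\<And>i. i < m \<Longrightarrow> 0 < \<sigma> i"
    and X: "X \<in> carrier_mat m m"
  defines "Y \<equiv> conj_diag m \<sigma> X"
  shows "solves_left m \<mu> \<sigma> Q X \<longleftrightarrow>
    Y * (- (2 \<cdot>\<^sub>m VinvD m \<mu> \<sigma>) - Y) = 2 \<cdot>\<^sub>m (diag_inv m (\<lambda>i. (\<sigma> i)\<^sup>2) * Q)"
proof -
  let ?VD = "VinvD m \<mu> \<sigma>" and ?C = "2 \<cdot>\<^sub>m (diag_inv m (\<lambda>i. (\<sigma> i)\<^sup>2) * Q)"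
  have Y: "Y \<in> carrier_mat m m" using X by (simp add: Y_def)
  have "Y * (- (2 \<cdot>\<^sub>m ?VD) - Y) = Y * (- (2 \<cdot>\<^sub>m ?VD)) - Y * Y"
    using Y by (intro mult_minus_distrib_mat) auto
  also have "Y * (- (2 \<cdot>\<^sub>m ?VD)) = - (Y * (2 \<cdot>\<^sub>m ?VD))"
    using Y by (intro uminus_mult_right_mat) auto
  also have "Y * (2 \<cdot>\<^sub>m ?VD) = 2 \<cdot>\<^sub>m (Y * ?VD)"
    using Y by (intro mult_smult_distrib) auto
  finally have fact: "Y * (- (2 \<cdot>\<^sub>m ?VD) - Y) = - (2 \<cdot>\<^sub>m (Y * ?VD)) - Y * Y" .
  let ?L = "X * X + 2 \<cdot>\<^sub>m (X * ?VD) + 2 \<cdot>\<^sub>m (diag_inv m \<sigma> * Q * diag_inv m \<sigma>)"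
  have L: "?L \<in> carrier_mat m m"
    using X Q by (auto intro!: mult_carrier_mat[of _ m m])
  have "conj_diag m \<sigma> ?L = Y * Y + 2 \<cdot>\<^sub>m (Y * ?VD) + ?C"
  proof (rule eq_matI)
    fix i j assume "i < dim_row (Y * Y + 2 \<cdot>\<^sub>m (Y * ?VD) + ?C)" "j < dim_col (Y * Y + 2 \<cdot>\<^sub>m (Y * ?VD) + ?C)"
    then have ij: "i < m" "j < m" using Q by auto
    have YY: "(Y * Y) $$ (i, j) = (X * X) $$ (i, j) * \<sigma> j / \<sigma> i"
      using conj_diag_mult[OF \<sigma> X X] index_conj_diag[of "X * X" m i j \<sigma>] X ij by (simp add: Y_def)
    have YV: "(Y * ?VD) $$ (i, j) = (X * ?VD) $$ (i, j) * \<sigma> j / \<sigma> i"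
      unfolding index_mult_VinvD[OF Y ij] index_mult_VinvD[OF X ij] by (simp add: Y_def index_conj_diag X ij mult.commute mult.left_commute)
    have QQ: "(diag_inv m \<sigma> * Q * diag_inv m \<sigma>) $$ (i, j) = Q $$ (i, j) / \<sigma> i / \<sigma> j"
      using Q ij by (simp add: index_mult_diag_inv[of _ m] index_diag_inv_mult[of _ _ m] mult_carrier_mat[of _ m m] del: index_mult_mat(1))
    show "conj_diag m \<sigma> ?L $$ (i, j) = (Y * Y + 2 \<cdot>\<^sub>m (Y * ?VD) + ?C) $$ (i, j)"
      using ij X Y Q \<sigma>[OF ij(1)] \<sigma>[OF ij(2)]
      by (simp add: index_conj_diag[OF L] YY YV QQ index_diag_inv_mult[OF Q ij] del: index_mult_mat(1))
        (simp add: field_simps power2_eq_square)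
  qed (use Q Y in \<open>simp_all add: carrier_matD[OF conj_diag_carrier[OF L]]\<close>)
  moreover have "conj_diag m \<sigma> (0\<^sub>m m m) = 0\<^sub>m m m"
    by (intro eq_matI) (auto simp: index_conj_diag carrier_matD[OF conj_diag_carrier])
  moreover have "?L = 0\<^sub>m m m \<longleftrightarrow> conj_diag m \<sigma> ?L = conj_diag m \<sigma> (0\<^sub>m m m)"
    using conj_diag_inject[of m \<sigma> ?L "0\<^sub>m m m", OF _ L zero_carrier_mat] \<sigma> by auto
  ultimately have "?L = 0\<^sub>m m m \<longleftrightarrow> Y * Y + 2 \<cdot>\<^sub>m (Y * ?VD) + ?C = 0\<^sub>m m m"
    by simp
  also have "\<dots> \<longleftrightarrow> - (2 \<cdot>\<^sub>m (Y * ?VD)) - Y * Y = ?C"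
    using Y Q by (intro mat_sum_eq_zero_iff) (auto intro!: mult_carrier_mat[of _ m m])
  finally show ?thesis
    using X by (simp add: solves_left_def fact)
qed

section \<open>First-order expansions of \<open>K_mat\<close> and \<open>K_star_mat\<close>\<close>

text \<open>One matrix entry: \<open>s\<close>, \<open>a\<close> are the \<sigma> and \<mu> of the
  row, \<open>t\<close>, \<open>b\<close> those of the column, \<open>q\<close> and
  \<open>\<psi>\<close> are entries of Q and \<Psi>1, and \<open>d\<close> is the entry of the
  identity. The hypothesis on \<open>d\<close> says that the two terms of order 1/\<epsilon> occur
  only on the diagonal, where they cancel and leave 2 a / s^2.\<close>

lemma K_entry_bigo:
  fixes s t a b d q \<psi> :: real
  assumes s: "s > 0" and t: "t > 0" and d: "d = 0 \<or> t = s \<and> b = a"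
    and p: "(\<lambda>\<epsilon>. p \<epsilon> - (d + \<epsilon> * \<psi>)) \<in> O[at_right 0](\<lambda>\<epsilon>. \<epsilon>\<^sup>2)"
  shows "(\<lambda>\<epsilon>. (q - d * inverse (\<epsilon>\<^sup>2)) / (inverse \<epsilon> * s + a) + p \<epsilon> / (inverse \<epsilon> * t - b) * inverse (\<epsilon>\<^sup>2)
      - (\<psi> / t + 2 * (d * a / s\<^sup>2))) \<in> O[at_right 0](\<lambda>\<epsilon>. \<epsilon>)"
proof -
  \<comment> \<open>\<open>G\<close> is chosen so that the difference equals \<epsilon> times
    \<open>G\<close> plus the contribution of the error of \<open>p\<close>. Its summands come from
    \<open>q\<close>, from \<psi> / (t - \<epsilon> b) - \<psi> / t, and from the cancelling poles
    after their limit is subtracted.\<close>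
  define G where "G \<epsilon> = q / (s + \<epsilon> * a) + \<psi> * b / (t * (t - \<epsilon> * b)) +
    2 * d * \<epsilon> * a ^ 3 / (s\<^sup>2 * ((s + \<epsilon> * a) * (s - \<epsilon> * a)))" for \<epsilon>
  define H where "H \<epsilon> = 1 / (t - \<epsilon> * b)" for \<epsilon>
  have "(G \<longlongrightarrow> q / (s + 0 * a) + \<psi> * b / (t * (t - 0 * b)) +
      2 * d * 0 * a ^ 3 / (s\<^sup>2 * ((s + 0 * a) * (s - 0 * a)))) (at_right 0)"
    unfolding G_def using s t by (intro tendsto_intros) auto
  then have G: "G \<in> O[at_right 0](\<lambda>_. 1)"
    by (intro bigoI_tendsto) auto
  have "(H \<longlongrightarrow> 1 / (t - 0 * b)) (at_right 0)"
    unfolding H_def using t by (intro tendsto_intros) auto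
  then have H: "H \<in> O[at_right 0](\<lambda>_. 1)"
    by (intro bigoI_tendsto) auto
  have pos: "\<forall>\<^sub>F \<epsilon> in at_right 0. (0::real) < \<epsilon>"
    by (rule eventually_at_right_less)
  have lin: "\<forall>\<^sub>F \<epsilon> in at_right 0. 0 < u + \<epsilon> * v" if "u > 0" for u v :: real
  proof (rule order_tendstoD(1))
    show "((\<lambda>\<epsilon>. u + \<epsilon> * v) \<longlongrightarrow> u + 0 * v) (at_right 0)"
      by (intro tendsto_intros)
  qed (use that in simp)
  have "(\<lambda>\<epsilon>. (p \<epsilon> - (d + \<epsilon> * \<psi>)) * inverse \<epsilon> * H \<epsilon>) \<in> O[at_right 0](\<lambda>\<epsilon>. \<epsilon>\<^sup>2 * inverse \<epsilon> * 1)"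
    by (intro landau_o.big.mult p H landau_o.big_refl)
  also have "(\<lambda>\<epsilon>. \<epsilon>\<^sup>2 * inverse \<epsilon> * 1) \<in> O[at_right 0](\<lambda>\<epsilon>::real. \<epsilon>)"
    using pos by (intro landau_o.big_mono) (auto elim!: eventually_mono simp: power2_eq_square)
  finally have 1: "(\<lambda>\<epsilon>. (p \<epsilon> - (d + \<epsilon> * \<psi>)) * inverse \<epsilon> * H \<epsilon>) \<in> O[at_right 0](\<lambda>\<epsilon>. \<epsilon>)" .
  have "(\<lambda>\<epsilon>. \<epsilon> * G \<epsilon>) \<in> O[at_right 0](\<lambda>\<epsilon>. \<epsilon> * 1)"
    by (intro landau_o.big.mult G landau_o.big_refl)
  then have "(\<lambda>\<epsilon>. \<epsilon> * G \<epsilon> + (p \<epsilon> - (d + \<epsilon> * \<psi>)) * inverse \<epsilon> * H \<epsilon>) \<in> O[at_right 0](\<lambda>\<epsilon>. \<epsilon>)"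
    using 1 by (intro sum_in_bigo) auto
  moreover have "\<forall>\<^sub>F \<epsilon> in at_right 0.
      (q - d * inverse (\<epsilon>\<^sup>2)) / (inverse \<epsilon> * s + a) + p \<epsilon> / (inverse \<epsilon> * t - b) * inverse (\<epsilon>\<^sup>2)
      - (\<psi> / t + 2 * (d * a / s\<^sup>2)) =
      \<epsilon> * G \<epsilon> + (p \<epsilon> - (d + \<epsilon> * \<psi>)) * inverse \<epsilon> * H \<epsilon>"
    using pos lin[OF s, of a] lin[OF t, of "- b"]
  proof eventually_elim
    case (elim \<epsilon>)
    have nz: "\<epsilon> \<noteq> 0" "s + \<epsilon> * a \<noteq> 0" "t - \<epsilon> * b \<noteq> 0" "s \<noteq> 0" "t \<noteq> 0" using elim s t by auto
    have "inverse \<epsilon> * s + a = (s + \<epsilon> * a) / \<epsilon>" "inverse \<epsilon> * t - b = (t - \<epsilon> * b) / \<epsilon>"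
      using nz by (simp_all add: field_simps)
    note rates = this
    have lhs: "(q - d * inverse (\<epsilon>\<^sup>2)) / (inverse \<epsilon> * s + a) + p \<epsilon> / (inverse \<epsilon> * t - b) * inverse (\<epsilon>\<^sup>2) =
        \<epsilon> * q / (s + \<epsilon> * a) - d / (\<epsilon> * (s + \<epsilon> * a)) + p \<epsilon> / (\<epsilon> * (t - \<epsilon> * b))"
    proof -
      have "(q - d * inverse (\<epsilon>\<^sup>2)) / ((s + \<epsilon> * a) / \<epsilon>) = \<epsilon> * q / (s + \<epsilon> * a) - d / (\<epsilon> * (s + \<epsilon> * a))"
        using nz by (simp add: divide_simps power2_eq_square)
      moreover have "p \<epsilon> / ((t - \<epsilon> * b) / \<epsilon>) * inverse (\<epsilon>\<^sup>2) = p \<epsilon> / (\<epsilon> * (t - \<epsilon> * b))"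
        using nz by (simp add: divide_simps power2_eq_square)
      ultimately show ?thesis
        by (simp only: rates)
    qed
    have \<psi>: "\<psi> * b / (t * (t - \<epsilon> * b)) * \<epsilon> = \<psi> / (t - \<epsilon> * b) - \<psi> / t"
      using nz by (simp add: field_simps)
    \<comment> \<open>For nonzero \<open>d\<close> the rates agree, and 1 / (\<epsilon> (s -
      \<epsilon> a)) - 1 / (\<epsilon> (s + \<epsilon> a)) = 2 a / (s^2 - \<epsilon>^2 a^2).\<close>
    have dd: "2 * d * \<epsilon> * a ^ 3 / (s\<^sup>2 * ((s + \<epsilon> * a) * (s - \<epsilon> * a))) * \<epsilon> =
      d / (\<epsilon> * (t - \<epsilon> * b)) - d / (\<epsilon> * (s + \<epsilon> * a)) - 2 * (d * a / s\<^sup>2)"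
    proof (cases "d = 0")
      case False
      then have "s - \<epsilon> * a \<noteq> 0" "t = s" "b = a" using d nz by auto
      then show ?thesis using nz by (simp add: divide_simps) (simp add: algebra_simps power2_eq_square power3_eq_cube)
    qed simp
    have "(p \<epsilon> - (d + \<epsilon> * \<psi>)) * inverse \<epsilon> * H \<epsilon> =
        p \<epsilon> / (\<epsilon> * (t - \<epsilon> * b)) - d / (\<epsilon> * (t - \<epsilon> * b)) - \<psi> / (t - \<epsilon> * b)"
      using nz by (simp add: H_def divide_simps)
    then show ?case
      unfolding lhs G_def using \<psi> dd by (simp add: algebra_simps)
  qed
  ultimately show ?thesis
    by (subst landau_o.big.in_cong)
qed

lemma index_mult_Toff:
  assumes "A \<in> carrier_mat m m" "i < m" "j < m"
  shows "(A * Toff m \<epsilon>) $$ (i, j) = A $$ (i, j) * inverse (\<epsilon>\<^sup>2)"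
proof -
  have "A * Toff m \<epsilon> = inverse (\<epsilon>\<^sup>2) \<cdot>\<^sub>m (A * 1\<^sub>m m)"
    unfolding Toff_def using assms by (intro mult_smult_distrib) auto
  then show ?thesis using assms by simp
qed

lemma index_K0_mat:
  assumes "\<Psi> \<in> carrier_mat m m" "i < m" "j < m"
  shows "K0_mat m \<mu> \<sigma> \<Psi> $$ (i, j) =
    \<Psi> $$ (i, j) / \<sigma> j + (if i = j then 2 * (\<mu> j / (\<sigma> j)\<^sup>2) else 0)"
  using assms
  by (simp add: K0_mat_def index_mult_diag_inv[OF assms] index_VinvD del: index_mult_mat(1))

lemma K0_mat_carrier [simp]: "\<Psi> \<in> carrier_mat m m \<Longrightarrow> K0_mat m \<mu> \<sigma> \<Psi> \<in> carrier_mat m m"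
  by (simp add: K0_mat_def mult_carrier_mat[of _ m m])

text \<open>Allows the facts about \<open>K0_mat\<close>, which are proved for arbitrary drifts, to
  be reused for the starred matrix.\<close>

lemma K0_star_mat_eq:
  assumes "\<Psi> \<in> carrier_mat m m"
  shows "K0_star_mat m \<mu> \<sigma> \<Psi> = K0_mat m (\<lambda>i. - \<mu> i) \<sigma> \<Psi>"
  using assms
  by (intro eq_matI) (auto simp: K0_star_mat_def K0_mat_def index_VinvD)

text \<open>For each of the finitely many phases it suffices that \<epsilon> times the absolute
  drift is below \<sigma>. The expansions need this to resolve the absolute value of
  \<open>Cminus\<close>.\<close>

lemma eventually_admissible:
  assumes "\<And>i. i < m \<Longrightarrow> 0 < \<sigma> i"
  shows "\<forall>\<^sub>F \<epsilon> in at_right 0. admissible m \<mu> \<sigma> \<epsilon>"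
proof -
  have pos: "\<forall>\<^sub>F \<epsilon> in at_right 0. (0::real) < \<epsilon>"
    by (rule eventually_at_right_less)
  have "\<forall>\<^sub>F \<epsilon> in at_right 0. 0 < Cplus \<mu> \<sigma> \<epsilon> i \<and> Cminus \<mu> \<sigma> \<epsilon> i < 0" if i: "i < m" for i
  proof -
    have "((\<lambda>\<epsilon>. \<epsilon> * \<bar>\<mu> i\<bar>) \<longlongrightarrow> 0 * \<bar>\<mu> i\<bar>) (at_right 0)"
      by (intro tendsto_intros)
    then have "\<forall>\<^sub>F \<epsilon> in at_right 0. \<epsilon> * \<bar>\<mu> i\<bar> < \<sigma> i"
      using assms[OF i] by (intro order_tendstoD(2)) auto
    then show ?thesis
      using pos
    proof eventually_elim
      case (elim \<epsilon>)
      then have "\<bar>\<mu> i\<bar> < inverse \<epsilon> * \<sigma> i" by (simp add: field_simps)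
      then show ?case by (auto simp: Cplus_def Cminus_def)
    qed
  qed
  then have "\<forall>\<^sub>F \<epsilon> in at_right 0. \<forall>i\<in>{..<m}. 0 < Cplus \<mu> \<sigma> \<epsilon> i \<and> Cminus \<mu> \<sigma> \<epsilon> i < 0"
    by (intro eventually_ball_finite) auto
  with pos show ?thesis
    by eventually_elim (simp add: admissible_def)
qed

lemma K_mat_expansion:
  assumes Q: "Q \<in> carrier_mat m m" and \<sigma>: "\<And>i. i < m \<Longrightarrow> 0 < \<sigma> i"
    and \<Psi>: "\<And>\<epsilon>. \<Psi> \<epsilon> \<in> carrier_mat m m" "\<Psi>1 \<in> carrier_mat m m"
    and exp: "mat_eq_up_to m \<Psi> (\<lambda>\<epsilon>. 1\<^sub>m m + \<epsilon> \<cdot>\<^sub>m \<Psi>1) (\<lambda>\<epsilon>. \<epsilon>\<^sup>2)"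
  shows "mat_eq_up_to m (\<lambda>\<epsilon>. K_mat m \<mu> \<sigma> Q \<epsilon> (\<Psi> \<epsilon>)) (\<lambda>\<epsilon>. K0_mat m \<mu> \<sigma> \<Psi>1) (\<lambda>\<epsilon>. \<epsilon>)"
  unfolding mat_eq_up_to_def
proof (intro allI impI)
  fix i j assume ij: "i < m" "j < m"
  have adm: "\<forall>\<^sub>F \<epsilon> in at_right 0. admissible m \<mu> \<sigma> \<epsilon>"
    using \<sigma> by (rule eventually_admissible)
  \<comment> \<open>The Kronecker delta meets the side condition of \<open>K_entry_bigo\<close>:
    either it is 0, or row and column share their parameters.\<close>
  define d :: real where "d = (if i = j then 1 else 0)"
  have "(\<lambda>\<epsilon>. \<Psi> \<epsilon> $$ (i, j) - (d + \<epsilon> * \<Psi>1 $$ (i, j))) \<in> O[at_right 0](\<lambda>\<epsilon>. \<epsilon>\<^sup>2)"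
    using exp ij \<Psi>(2) by (auto simp: mat_eq_up_to_def d_def)
  then have "(\<lambda>\<epsilon>. (Q $$ (i, j) - d * inverse (\<epsilon>\<^sup>2)) / (inverse \<epsilon> * \<sigma> i + \<mu> i) +
      \<Psi> \<epsilon> $$ (i, j) / (inverse \<epsilon> * \<sigma> j - \<mu> j) * inverse (\<epsilon>\<^sup>2) -
      (\<Psi>1 $$ (i, j) / \<sigma> j + 2 * (d * \<mu> i / (\<sigma> i)\<^sup>2))) \<in> O[at_right 0](\<lambda>\<epsilon>. \<epsilon>)"
    by (rule K_entry_bigo[OF \<sigma>[OF ij(1)] \<sigma>[OF ij(2)], rotated]) (auto simp: d_def)
  moreover have "\<forall>\<^sub>F \<epsilon> in at_right 0.
      (Q $$ (i, j) - d * inverse (\<epsilon>\<^sup>2)) / (inverse \<epsilon> * \<sigma> i + \<mu> i) +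
      \<Psi> \<epsilon> $$ (i, j) / (inverse \<epsilon> * \<sigma> j - \<mu> j) * inverse (\<epsilon>\<^sup>2) -
      (\<Psi>1 $$ (i, j) / \<sigma> j + 2 * (d * \<mu> i / (\<sigma> i)\<^sup>2)) =
      K_mat m \<mu> \<sigma> Q \<epsilon> (\<Psi> \<epsilon>) $$ (i, j) - K0_mat m \<mu> \<sigma> \<Psi>1 $$ (i, j)"
    using adm
  proof eventually_elim
    case (elim \<epsilon>)
    have T: "Tdiag m Q \<epsilon> \<in> carrier_mat m m" by (simp add: Tdiag_def minus_carrier_mat)
    have "K_mat m \<mu> \<sigma> Q \<epsilon> (\<Psi> \<epsilon>) $$ (i, j) =
        (Q $$ (i, j) - d * inverse (\<epsilon>\<^sup>2)) / Cplus \<mu> \<sigma> \<epsilon> i +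
        \<Psi> \<epsilon> $$ (i, j) / \<bar>Cminus \<mu> \<sigma> \<epsilon> j\<bar> * inverse (\<epsilon>\<^sup>2)"
      using ij \<Psi>(1)[of \<epsilon>] Q T index_diag_inv_mult[OF T ij, of "Cplus \<mu> \<sigma> \<epsilon>"]
        index_mult_diag_inv[OF \<Psi>(1)[of \<epsilon>] ij, of "\<lambda>i. \<bar>Cminus \<mu> \<sigma> \<epsilon> i\<bar>"]
        index_mult_Toff[of "\<Psi> \<epsilon> * diag_inv m (\<lambda>i. \<bar>Cminus \<mu> \<sigma> \<epsilon> i\<bar>)" m i j \<epsilon>]
      by (simp add: K_mat_def mult_carrier_mat[of _ m m] Tdiag_def d_def Toff_def del: index_mult_mat(1))
    moreover have "K0_mat m \<mu> \<sigma> \<Psi>1 $$ (i, j) = \<Psi>1 $$ (i, j) / \<sigma> j + 2 * (d * \<mu> i / (\<sigma> i)\<^sup>2)"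
      using ij by (simp add: index_K0_mat[OF \<Psi>(2)] d_def)
    moreover have "\<bar>Cminus \<mu> \<sigma> \<epsilon> j\<bar> = inverse \<epsilon> * \<sigma> j - \<mu> j"
    proof -
      have "Cminus \<mu> \<sigma> \<epsilon> j < 0" using elim ij by (simp add: admissible_def)
      then show ?thesis by (simp add: Cminus_def)
    qed
    ultimately show ?case
      by (simp add: Cplus_def add.commute)
  qed
  ultimately show "(\<lambda>\<epsilon>. K_mat m \<mu> \<sigma> Q \<epsilon> (\<Psi> \<epsilon>) $$ (i, j) - K0_mat m \<mu> \<sigma> \<Psi>1 $$ (i, j)) \<in> O[at_right 0](\<lambda>\<epsilon>. \<epsilon>)"
    by (rule landau_o.big.in_cong[THEN iffD1, rotated])
qed

text \<open>Reversing the signs of the drifts interchanges the roles of \<open>K\<close> and \<open>K\<^sup>*\<close>.\<close>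

lemma K_star_mat_expansion:
  assumes Q: "Q \<in> carrier_mat m m" and \<sigma>: "\<And>i. i < m \<Longrightarrow> 0 < \<sigma> i"
    and \<Psi>: "\<And>\<epsilon>. \<Psi> \<epsilon> \<in> carrier_mat m m" "\<Psi>1 \<in> carrier_mat m m"
    and exp: "mat_eq_up_to m \<Psi> (\<lambda>\<epsilon>. 1\<^sub>m m + \<epsilon> \<cdot>\<^sub>m \<Psi>1) (\<lambda>\<epsilon>. \<epsilon>\<^sup>2)"
  shows "mat_eq_up_to m (\<lambda>\<epsilon>. K_star_mat m \<mu> \<sigma> Q \<epsilon> (\<Psi> \<epsilon>)) (\<lambda>\<epsilon>. K0_star_mat m \<mu> \<sigma> \<Psi>1) (\<lambda>\<epsilon>. \<epsilon>)"
proof -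
  have adm: "\<forall>\<^sub>F \<epsilon> in at_right 0. admissible m \<mu> \<sigma> \<epsilon>"
    using \<sigma> by (rule eventually_admissible)
  let ?\<nu> = "\<lambda>i. - \<mu> i"
  have eq: "K_mat m ?\<nu> \<sigma> Q \<epsilon> (\<Psi> \<epsilon>) = K_star_mat m \<mu> \<sigma> Q \<epsilon> (\<Psi> \<epsilon>)" if "admissible m \<mu> \<sigma> \<epsilon>" for \<epsilon>
  proof -
    \<comment> \<open>Negating the drift turns \<open>Cplus\<close> into the negative of
      \<open>Cminus\<close> and vice versa; admissibility supplies the signs.\<close>
    have "diag_inv m (Cplus ?\<nu> \<sigma> \<epsilon>) = diag_inv m (\<lambda>i. \<bar>Cminus \<mu> \<sigma> \<epsilon> i\<bar>)"
      "diag_inv m (\<lambda>i. \<bar>Cminus ?\<nu> \<sigma> \<epsilon> i\<bar>) = diag_inv m (Cplus \<mu> \<sigma> \<epsilon>)"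
      using that by (auto simp: diag_inv_def mat_diag_def admissible_def Cplus_def Cminus_def mat_eq_iff)
    then show ?thesis
      unfolding K_mat_def K_star_mat_def using Q \<Psi>(1)[of \<epsilon>]
      by (subst comm_add_mat[of _ m m]) (auto simp: Tdiag_def Toff_def intro!: mult_carrier_mat[of _ m m] minus_carrier_mat)
  qed
  show ?thesis
    unfolding mat_eq_up_to_def
  proof (intro allI impI)
    fix i j assume ij: "i < m" "j < m"
    have "(\<lambda>\<epsilon>. K_mat m ?\<nu> \<sigma> Q \<epsilon> (\<Psi> \<epsilon>) $$ (i, j) - K0_star_mat m \<mu> \<sigma> \<Psi>1 $$ (i, j)) \<in> O[at_right 0](\<lambda>\<epsilon>. \<epsilon>)"
      using K_mat_expansion[OF assms, where \<mu> = ?\<nu>] ij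
      by (simp add: mat_eq_up_to_def K0_star_mat_eq[OF \<Psi>(2)])
    moreover have "\<forall>\<^sub>F \<epsilon> in at_right 0. K_mat m ?\<nu> \<sigma> Q \<epsilon> (\<Psi> \<epsilon>) $$ (i, j) - K0_star_mat m \<mu> \<sigma> \<Psi>1 $$ (i, j) =
        K_star_mat m \<mu> \<sigma> Q \<epsilon> (\<Psi> \<epsilon>) $$ (i, j) - K0_star_mat m \<mu> \<sigma> \<Psi>1 $$ (i, j)"
      using adm by eventually_elim (simp add: eq)
    ultimately show "(\<lambda>\<epsilon>. K_star_mat m \<mu> \<sigma> Q \<epsilon> (\<Psi> \<epsilon>) $$ (i, j) - K0_star_mat m \<mu> \<sigma> \<Psi>1 $$ (i, j)) \<in> O[at_right 0](\<lambda>\<epsilon>. \<epsilon>)"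
      by (rule landau_o.big.in_cong[THEN iffD1, rotated])
  qed
qed

section \<open>The limit matrices as conjugated left factors\<close>

text \<open>Off the diagonal both matrices are \<Psi> with its entries divided by positive numbers,
  and diagonal entries never lead out of a set of indices.\<close>

lemma irreducible_mat_K0:
  assumes irr: "irreducible_mat m (diag_inv m \<sigma> * \<Psi>)" and \<Psi>: "\<Psi> \<in> carrier_mat m m"
    and \<sigma>: "\<And>i. i < m \<Longrightarrow> 0 < \<sigma> i"
  shows "irreducible_mat m (K0_mat m \<mu> \<sigma> \<Psi>)"
proof (rule irreducible_mat_transfer[OF irr], intro ballI)
  fix A i j
  assume A: "A \<subseteq> {..<m}" and closed: "\<forall>i\<in>A. \<forall>j\<in>{..<m} - A. K0_mat m \<mu> \<sigma> \<Psi> $$ (i, j) = 0"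
    and i: "i \<in> A" and j: "j \<in> {..<m} - A"
  have ij: "i < m" "j < m" "i \<noteq> j" using A i j by auto
  then have "\<Psi> $$ (i, j) / \<sigma> j = 0"
    using closed i j index_K0_mat[OF \<Psi> ij(1,2), of \<mu> \<sigma>] by simp
  then show "(diag_inv m \<sigma> * \<Psi>) $$ (i, j) = 0"
    using \<sigma>[OF ij(2)] index_diag_inv_mult[OF \<Psi> ij(1,2)] by simp
qed

text \<open>With U = \<Theta>^-1 \<Psi> and B = 2 V^-1 D the right-hand side is U + B, so the
  negative of \<open>K0_mat\<close> is similar to the left factor - B - U that accompanies
  \<open>U\<close>.\<close>

lemma conj_diag_K0:
  assumes \<Psi>: "\<Psi> \<in> carrier_mat m m" and \<sigma>: "\<And>i. i < m \<Longrightarrow> 0 < \<sigma> i"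
  shows "conj_diag m \<sigma> (K0_mat m \<mu> \<sigma> \<Psi>) = diag_inv m \<sigma> * \<Psi> + 2 \<cdot>\<^sub>m VinvD m \<mu> \<sigma>"
proof (rule eq_matI)
  fix i j
  assume "i < dim_row (diag_inv m \<sigma> * \<Psi> + 2 \<cdot>\<^sub>m VinvD m \<mu> \<sigma>)" "j < dim_col (diag_inv m \<sigma> * \<Psi> + 2 \<cdot>\<^sub>m VinvD m \<mu> \<sigma>)"
  then have ij: "i < m" "j < m" by auto
  have "\<sigma> i \<noteq> 0" "\<sigma> j \<noteq> 0" using \<sigma>[OF ij(1)] \<sigma>[OF ij(2)] by auto
  then show "conj_diag m \<sigma> (K0_mat m \<mu> \<sigma> \<Psi>) $$ (i, j) = (diag_inv m \<sigma> * \<Psi> + 2 \<cdot>\<^sub>m VinvD m \<mu> \<sigma>) $$ (i, j)"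
    using ij \<Psi>
    by (simp add: index_diag_inv_mult[OF \<Psi> ij] index_conj_diag index_K0_mat index_VinvD field_simps del: index_mult_mat(1))
qed (use conj_diag_carrier[OF K0_mat_carrier[OF \<Psi>]] in auto)

lemma conj_diag_uminus:
  "X \<in> carrier_mat m m \<Longrightarrow> conj_diag m \<sigma> (- X) = - conj_diag m \<sigma> X"
  by (intro eq_matI) (auto simp: index_conj_diag carrier_matD[OF conj_diag_carrier])

lemma solvent_eigs:
  fixes B U U' :: "real mat"
  assumes carr: "B \<in> carrier_mat n n" "U \<in> carrier_mat n n" "U' \<in> carrier_mat n n"
    and eq: "(- B - U) * U = (- B - U') * U'"
  shows "eigs (- B - U) + eigs U = eigs (- B - U') + eigs U'"
proof (rule eigs_add_cong[of _ n, OF _ _ _ _ _ eq])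
  show "- B - U + U = - B - U' + U'"
    using carr by (intro eq_matI) auto
qed (use carr in \<open>auto simp: minus_carrier_mat\<close>)

theorem lemma3p6:
  fixes m :: nat and Q \<Psi>1 \<Psi>1s :: "real mat" and \<alpha> \<mu> \<sigma> :: "nat \<Rightarrow> real" and x :: real
    and P :: "real \<Rightarrow> real \<Rightarrow> nat \<times> nat \<Rightarrow> 'w measure"
    and \<beta> \<phi> :: "real \<Rightarrow> real \<Rightarrow> 'w \<Rightarrow> nat" and L :: "real \<Rightarrow> real \<Rightarrow> 'w \<Rightarrow> real"
  assumes m: "m \<ge> 1"
    and Q: "generator_mat m Q" "irreducible_mat m Q"
    and \<alpha>: "stationary_dist m Q \<alpha>"
    and \<sigma>: "\<And>i. i < m \<Longrightarrow> 0 < \<sigma> i"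
    and drift: "(\<Sum>i<m. \<alpha> i * \<mu> i) < 0"
    and queue: "\<And>\<epsilon> y b i. admissible m \<mu> \<sigma> \<epsilon> \<Longrightarrow> b \<in> {1, 2} \<Longrightarrow> i < m \<Longrightarrow>
      fluid_queue m \<mu> \<sigma> Q \<epsilon> (P \<epsilon> y (b, i)) y (b, i) (\<beta> \<epsilon>) (\<phi> \<epsilon>) (L \<epsilon>)"
    and \<Psi>1: "\<Psi>1 \<in> carrier_mat m m"
      "mat_eq_up_to m (\<lambda>\<epsilon>. Psi m (P \<epsilon>) (\<beta> \<epsilon>) (\<phi> \<epsilon>) (L \<epsilon>) x) (\<lambda>\<epsilon>. 1\<^sub>m m + \<epsilon> \<cdot>\<^sub>m \<Psi>1) (\<lambda>\<epsilon>. \<epsilon>\<^sup>2)"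
      "solves_right m \<mu> \<sigma> Q (diag_inv m \<sigma> * \<Psi>1)"
      "one_zero_rest_neg m (diag_inv m \<sigma> * \<Psi>1)"
    and \<Psi>1s: "\<Psi>1s \<in> carrier_mat m m"
      "mat_eq_up_to m (\<lambda>\<epsilon>. Psi_star m (P \<epsilon>) (\<beta> \<epsilon>) (\<phi> \<epsilon>) (L \<epsilon>) x) (\<lambda>\<epsilon>. 1\<^sub>m m + \<epsilon> \<cdot>\<^sub>m \<Psi>1s) (\<lambda>\<epsilon>. \<epsilon>\<^sup>2)"
      "solves_right m \<mu> \<sigma> Q (- (diag_inv m \<sigma> * \<Psi>1s))"
      "all_pos m (- (diag_inv m \<sigma> * \<Psi>1s))"
  shows "mat_eq_up_to m (\<lambda>\<epsilon>. K_mat m \<mu> \<sigma> Q \<epsilon> (Psi m (P \<epsilon>) (\<beta> \<epsilon>) (\<phi> \<epsilon>) (L \<epsilon>) x))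
           (\<lambda>\<epsilon>. K0_mat m \<mu> \<sigma> \<Psi>1) (\<lambda>\<epsilon>. \<epsilon>) \<and>
         mat_eq_up_to m (\<lambda>\<epsilon>. K_star_mat m \<mu> \<sigma> Q \<epsilon> (Psi_star m (P \<epsilon>) (\<beta> \<epsilon>) (\<phi> \<epsilon>) (L \<epsilon>) x))
           (\<lambda>\<epsilon>. K0_star_mat m \<mu> \<sigma> \<Psi>1s) (\<lambda>\<epsilon>. \<epsilon>) \<and>
         solves_left m \<mu> \<sigma> Q (- K0_mat m \<mu> \<sigma> \<Psi>1) \<and>
         solves_left m \<mu> \<sigma> Q (K0_star_mat m \<mu> \<sigma> \<Psi>1s) \<and>
         irreducible_mat m (K0_mat m \<mu> \<sigma> \<Psi>1) \<and>
         irreducible_mat m (K0_star_mat m \<mu> \<sigma> \<Psi>1s) \<and>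
         all_neg m (K0_mat m \<mu> \<sigma> \<Psi>1) \<and>
         (\<forall>K \<in> carrier_mat m m. solves_left m \<mu> \<sigma> Q (- K) \<and> all_neg m K \<longrightarrow>
            K = K0_mat m \<mu> \<sigma> \<Psi>1) \<and>
         one_zero_rest_neg m (K0_star_mat m \<mu> \<sigma> \<Psi>1s) \<and>
         (\<forall>K \<in> carrier_mat m m. solves_left m \<mu> \<sigma> Q K \<and> one_zero_rest_neg m K \<longrightarrow>
            K = K0_star_mat m \<mu> \<sigma> \<Psi>1s)"
proof -
  have Qc: "Q \<in> carrier_mat m m" using Q(1) by (simp add: generator_mat_def)
  let ?K = "K0_mat m \<mu> \<sigma> \<Psi>1" and ?Ks = "K0_star_mat m \<mu> \<sigma> \<Psi>1s"
  define B where "B = 2 \<cdot>\<^sub>m VinvD m \<mu> \<sigma>"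
  define C where "C = 2 \<cdot>\<^sub>m (diag_inv m (\<lambda>i. (\<sigma> i)\<^sup>2) * Q)"
  define U where "U = diag_inv m \<sigma> * \<Psi>1"
  define W where "W = - (diag_inv m \<sigma> * \<Psi>1s)"
  have carr [simp]: "B \<in> carrier_mat m m" "U \<in> carrier_mat m m" "W \<in> carrier_mat m m"
    using \<Psi>1(1) \<Psi>1s(1) by (auto simp: B_def U_def W_def mult_carrier_mat[of _ m m])
  note dims [simp] = carr[THEN carrier_matD(1)] carr[THEN carrier_matD(2)]
  have carr' [simp]: "- B - X \<in> carrier_mat m m" if "X \<in> carrier_mat m m" for X
    using that by (simp add: minus_carrier_mat)
  have Kc: "?K \<in> carrier_mat m m" "?Ks \<in> carrier_mat m m"
    using \<Psi>1(1) \<Psi>1s(1) by (simp_all add: K0_star_mat_eq)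
  \<comment> \<open>The map sending X to - B - X exchanges the two factors and is an
    involution.\<close>
  have compl: "- B - (- B - X) = X" if "X \<in> carrier_mat m m" for X
    using that carr(1) by (intro eq_matI) auto
  have U: "(- B - U) * U = C" and W: "(- B - W) * W = C"
    using \<Psi>1(3) \<Psi>1s(3) solves_right_iff[OF Qc] by (simp_all add: B_def C_def U_def W_def)
  \<comment> \<open>Written so that - B - \<Theta>^-1 X \<Theta> appears as a right solvent, the
    form to which \<open>solvent_eigs\<close> and \<open>solvent_unique\<close> apply.\<close>
  have left: "solves_left m \<mu> \<sigma> Q X \<longleftrightarrow> (- B - (- B - conj_diag m \<sigma> X)) * (- B - conj_diag m \<sigma> X) = C"
    if "X \<in> carrier_mat m m" for X
    using solves_left_iff[OF Qc \<sigma> that, where \<mu> = \<mu>] that by (simp add: compl B_def[symmetric] C_def)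
  have eigs_conj: "eigs (conj_diag m \<sigma> X) = eigs X" if "X \<in> carrier_mat m m" for X
    by (rule eigs_similar[OF conj_diag_similar[OF \<sigma> that]])
  have conj_K0: "conj_diag m \<sigma> (K0_mat m \<nu> \<sigma> \<Psi>) = diag_inv m \<sigma> * \<Psi> + 2 \<cdot>\<^sub>m VinvD m \<nu> \<sigma>"
    if "\<Psi> \<in> carrier_mat m m" for \<nu> \<Psi>
    using that \<sigma> by (rule conj_diag_K0)
  have conjK: "conj_diag m \<sigma> (- ?K) = - B - U"
    unfolding conj_diag_uminus[OF Kc(1)] conj_K0[OF \<Psi>1(1)] B_def[symmetric] U_def[symmetric]
    by (intro eq_matI) auto
  have VinvD_neg: "VinvD m (\<lambda>i. - \<mu> i) \<sigma> = - VinvD m \<mu> \<sigma>"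
    by (intro eq_matI) (auto simp: index_VinvD)
  have conjKs: "conj_diag m \<sigma> ?Ks = - B - W"
    unfolding K0_star_mat_eq[OF \<Psi>1s(1)] conj_K0[OF \<Psi>1s(1)] VinvD_neg
    using \<Psi>1s(1) by (intro eq_matI) (auto simp: B_def W_def)
  have Upos: "\<forall>z\<in>#eigs U. \<not> Re z > 0"
    using one_zero_rest_neg_nonpos[OF carr(2) m] \<Psi>1(4) by (simp add: U_def)
  have Wpos: "\<forall>z\<in>#eigs W. Re z > 0"
    using \<Psi>1s(4) all_pos_iff[OF carr(3)] by (simp add: W_def)
  have "eigs (- B - U) + eigs U = eigs W + eigs (- B - W)"
    using solvent_eigs[of B m U W] U W by (simp add: add.commute)
  \<comment> \<open>All four multisets have size \<open>m\<close>. The eigenvalues of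
    \<open>W\<close> lie in the open right half-plane and those of \<open>U\<close> outside it, so
    the splitting is forced.\<close>
  then have spec: "eigs (- B - U) = eigs W" "eigs U = eigs (- B - W)"
    using mset_split_by[of _ _ _ _ "\<lambda>z. Re z > 0", OF _ _ Wpos Upos] size_eigs[of _ m] by simp_all
  have eigsK: "eigs (- ?K) = eigs W" and eigsKs: "eigs ?Ks = eigs U"
    using eigs_conj[of "- ?K"] eigs_conj[of ?Ks] Kc spec conjK conjKs by simp_all
  have "all_neg m ?K"
    using \<Psi>1s(4) eigsK by (simp add: all_neg_iff[OF Kc(1)] all_pos_def W_def)
  moreover have "one_zero_rest_neg m ?Ks"
    using \<Psi>1(4) eigsKs by (simp add: one_zero_rest_neg_def U_def)
  moreover have "solves_left m \<mu> \<sigma> Q (- ?K)" "solves_left m \<mu> \<sigma> Q ?Ks"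
    using left[of "- ?K"] left[of ?Ks] Kc U W by (simp_all add: conjK conjKs compl)
  moreover have "K = ?K"
    if K: "K \<in> carrier_mat m m" "solves_left m \<mu> \<sigma> Q (- K)" "all_neg m K" for K
  proof -
    define Y where "Y = conj_diag m \<sigma> (- K)"
    have Yc: "Y \<in> carrier_mat m m" using K by (simp add: Y_def)
    have eq: "(- B - U) * U = (- B - (- B - Y)) * (- B - Y)"
      using left[of "- K"] K U by (simp add: Y_def)
    have pos: "\<forall>z\<in>#eigs Y. Re z > 0"
      using K all_pos_iff[of "- K" m] by (simp add: Y_def eigs_conj all_neg_iff)
    have "eigs (- B - U) + eigs U = eigs Y + eigs (- B - Y)"
      using solvent_eigs[of B m U "- B - Y"] eq Yc by (simp add: compl)
    then have "eigs U = eigs (- B - Y)"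
      using mset_split_by[of _ _ _ _ "\<lambda>z. Re z > 0", OF _ _ pos Upos] size_eigs[of _ m] Yc by simp
    \<comment> \<open>The two spectra to be compared are those of - B - U, equal to that of
      \<open>W\<close>, and of - B - Y, equal to that of \<open>U\<close>; the imaginary axis
      separates them.\<close>
    then have "U = - B - Y"
      using solvent_unique[of B m U "- B - Y"] eq Yc Upos Wpos spec(1) by auto
    then have "conj_diag m \<sigma> (- K) = conj_diag m \<sigma> (- ?K)"
      using Yc by (simp add: conjK compl Y_def)
    then have "- K = - ?K"
      by (rule conj_diag_inject[OF \<sigma>, rotated -1]) (use K Kc in auto)
    then show ?thesis
      by (metis uminus_uminus_mat)
  qed
  moreover have "K = ?Ks"
    if K: "K \<in> carrier_mat m m" "solves_left m \<mu> \<sigma> Q K" "one_zero_rest_neg m K" for K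
  proof -
    define Y where "Y = conj_diag m \<sigma> K"
    have Yc: "Y \<in> carrier_mat m m" using K by (simp add: Y_def)
    have eq: "(- B - W) * W = (- B - (- B - Y)) * (- B - Y)"
      using left[of K] K W by (simp add: Y_def)
    have nonpos: "\<forall>z\<in>#eigs Y. \<not> Re z > 0"
      using one_zero_rest_neg_nonpos[OF K(1) m K(3)] K by (simp add: Y_def eigs_conj)
    have "eigs (- B - Y) + eigs Y = eigs W + eigs (- B - W)"
      using solvent_eigs[of B m W "- B - Y"] eq Yc by (simp add: compl add.commute)
    then have "eigs (- B - Y) = eigs W"
      using mset_split_by[of _ _ _ _ "\<lambda>z. Re z > 0", OF _ _ Wpos nonpos] size_eigs[of _ m] Yc by simp
    \<comment> \<open>The same separation with the sides exchanged: - B - W has the spectrum of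
      \<open>U\<close>, and - B - Y that of \<open>W\<close>.\<close>
    then have "W = - B - Y"
      using solvent_unique[of B m W "- B - Y"] eq Yc Upos Wpos spec(2) by auto
    then have "conj_diag m \<sigma> K = conj_diag m \<sigma> ?Ks"
      using Yc by (simp add: conjKs compl Y_def)
    then show ?thesis
      by (rule conj_diag_inject[OF \<sigma>, rotated -1]) (use K Kc in auto)
  qed
  moreover have "irreducible_mat m ?K"
    using solves_right_irreducible[OF Qc Q(2) \<sigma> \<Psi>1(3)]
    by (intro irreducible_mat_K0 \<Psi>1(1) \<sigma>) auto
  moreover have "irreducible_mat m ?Ks"
  proof -
    have "irreducible_mat m (- (diag_inv m \<sigma> * \<Psi>1s))"
      by (rule solves_right_irreducible[OF Qc Q(2) \<sigma> \<Psi>1s(3)])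
    then have "irreducible_mat m (diag_inv m \<sigma> * \<Psi>1s)"
      by (rule irreducible_mat_transfer) (use \<Psi>1s(1) in \<open>auto simp: subset_iff\<close>)
    then show ?thesis
      unfolding K0_star_mat_eq[OF \<Psi>1s(1)] by (intro irreducible_mat_K0 \<Psi>1s(1) \<sigma>) auto
  qed
  moreover have "mat_eq_up_to m (\<lambda>\<epsilon>. K_mat m \<mu> \<sigma> Q \<epsilon> (Psi m (P \<epsilon>) (\<beta> \<epsilon>) (\<phi> \<epsilon>) (L \<epsilon>) x))
      (\<lambda>\<epsilon>. ?K) (\<lambda>\<epsilon>. \<epsilon>)"
    by (rule K_mat_expansion[OF Qc \<sigma> _ \<Psi>1(1,2)]) (auto simp: Psi_def)
  moreover have "mat_eq_up_to m (\<lambda>\<epsilon>. K_star_mat m \<mu> \<sigma> Q \<epsilon> (Psi_star m (P \<epsilon>) (\<beta> \<epsilon>) (\<phi> \<epsilon>) (L \<epsilon>) x))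
      (\<lambda>\<epsilon>. ?Ks) (\<lambda>\<epsilon>. \<epsilon>)"
    by (rule K_star_mat_expansion[OF Qc \<sigma> _ \<Psi>1s(1,2)]) (auto simp: Psi_star_def)
  ultimately show ?thesis by blast
qed

end
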